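(* For any integer $n$, set $$T(n)=\frac{n^2-3n}{2}-\left\lceil\frac{n}{2}\right\rceil+2 .$$ Then for every integer $n\ge 8$, every finite simple graph with $n$ vertices and more than $T(n)$ edges has positive Lin--Lu--Yau curvature, i.e. $\kappa_{LLY}(x,y)>0$ for every edge $xy$. Moreover, for every even integer $n\ge 12$, there exists, up to isomorphism, exactly one finite simple graph with $n$ vertices and exactly $T(n)$ edges that has an edge $xy$ with $\kappa_{LLY}(x,y)\le 0$.
   Context: Graphs are finite and simple; $\rho$ is the graph distance and $d_x$ the degree of $x$. For a vertex $x$ with $d_x\ge 1$ and $p\in[0,1]$, $\mu_x^p$ is the probability measure on $V$ with $\mu_x^p(x)=p$, $\mu_x^p(z)=\frac{1-p}{d_x}$ if $xz\in E$, and $\mu_x^p(z)=0$ otherwise. For probability measures $\mu_1,\mu_2$ on $V$, $W(\mu_1,\mu_2)=\inf_\pi\sum_{u,v\in V}\rho(u,v)\pi(u,v)$, the infimum being over all $\pi:V\times V\to[0,1]$ with $\sum_{v}\pi(u,v)=\mu_1(u)$ for all $u$ and $\sum_u\pi(u,v)=\mu_2(v)$ for all $v$. For an edge $xy$, $\kappa_p(x,y)=1-W(\mu_x^p,\mu_y^p)$ and the Lin--Lu--Yau curvature is $\kappa_{LLY}(x,y)=\lim_{p\to1}\frac{\kappa_p(x,y)}{1-p}$ (this limit exists). *)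

theory Defs
  imports
    "Graph_Theory.Pair_Digraph"
    "Graph_Theory.Shortest_Path"
    "Graph_Theory.Digraph_Isomorphism"
begin

text \<open>
  A finite simple graph is a \<open>pair_graph\<close>: a finite, symmetric, loop-free digraph whose arcs are
  pairs of vertices. An undirected edge \<open>xy\<close> is thus represented by the two arcs \<open>(x, y)\<close> and
  \<open>(y, x)\<close>, so edges have to be counted as unordered pairs, and the degree of a vertex is its
  out-degree.
\<close>

definition num_edges :: "'a pair_pre_digraph \<Rightarrow> nat" where
  "num_edges G = card ((\<lambda>(u, v). {u, v}) ` parcs G)"

text \<open>The distance is \<open>\<infinity>\<close> between vertices in different components.\<close>

definition graph_dist :: "'a pair_pre_digraph \<Rightarrow> 'a \<Rightarrow> 'a \<Rightarrow> ereal" where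
  "graph_dist G u v = wf_digraph.\<mu> (with_proj G) (\<lambda>_. 1) u v"

definition lazy_walk_measure :: "'a pair_pre_digraph \<Rightarrow> real \<Rightarrow> 'a \<Rightarrow> 'a \<Rightarrow> real" where
  "lazy_walk_measure G p x z =
     (if z = x then p
      else if (x, z) \<in> parcs G then (1 - p) / real (out_degree (with_proj G) x)
      else 0)"

definition couplings ::
    "'a pair_pre_digraph \<Rightarrow> ('a \<Rightarrow> real) \<Rightarrow> ('a \<Rightarrow> real) \<Rightarrow> ('a \<times> 'a \<Rightarrow> real) set" where
  "couplings G m1 m2 =
     {\<pi>. (\<forall>u\<in>pverts G. \<forall>v\<in>pverts G. \<pi> (u, v) \<in> {0..1}) \<and>
         (\<forall>u\<in>pverts G. (\<Sum>v\<in>pverts G. \<pi> (u, v)) = m1 u) \<and>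
         (\<forall>v\<in>pverts G. (\<Sum>u\<in>pverts G. \<pi> (u, v)) = m2 v)}"

text \<open>In \<^typ>\<open>ereal\<close> we have \<open>\<infinity> * 0 = 0\<close>: pairs at infinite distance that carry no mass are free.\<close>

definition transport_dist ::
    "'a pair_pre_digraph \<Rightarrow> ('a \<Rightarrow> real) \<Rightarrow> ('a \<Rightarrow> real) \<Rightarrow> ereal" where
  "transport_dist G m1 m2 =
     (INF \<pi>\<in>couplings G m1 m2.
        \<Sum>u\<in>pverts G. \<Sum>v\<in>pverts G. graph_dist G u v * ereal (\<pi> (u, v)))"

text \<open>
  For an edge \<open>xy\<close> and \<open>p \<in> {0..1}\<close> both measures live on the component of \<open>x\<close> and \<open>y\<close>, so the
  transport distance is finite and the conversion to \<^typ>\<open>real\<close> loses nothing.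
\<close>

definition kappa :: "'a pair_pre_digraph \<Rightarrow> real \<Rightarrow> 'a \<Rightarrow> 'a \<Rightarrow> real" where
  "kappa G p x y =
     1 - real_of_ereal (transport_dist G (lazy_walk_measure G p x) (lazy_walk_measure G p y))"

definition kappa_LLY :: "'a pair_pre_digraph \<Rightarrow> 'a \<Rightarrow> 'a \<Rightarrow> real" where
  "kappa_LLY G x y = Lim (at_left 1) (\<lambda>p. kappa G p x y / (1 - p))"

definition edge_threshold :: "int \<Rightarrow> real" where
  "edge_threshold n =
     (of_int n ^ 2 - 3 * of_int n) / 2 - of_int \<lceil>of_int n / 2 :: real\<rceil> + 2"

end

(*
  The ratio kappa_p / (1 - p) is nondecreasing in p and bounded, so the curvature is its supremum,
  and it is nonpositive iff the transport distance is at least 1 for all p. An integral form of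
  Kantorovich duality then turns nonpositive curvature of an edge xy into an integer-valued
  1-Lipschitz function f on the neighbourhoods of x and y with f x = 0 and f y = 1 whose average
  over the neighbours of y exceeds its average over the neighbours of x by at least 1. Vertices on
  which f differs by 2 or more are not adjacent, and neither x nor y is adjacent to vertices outside
  its neighbourhood; counting these non-edges by the values of f gives at least (3n - 4) / 2 of
  them, and for n >= 12 equality forces the structure of the whole graph.
*)
theory Submission
  imports Defs
begin

section \<open>Integral transport duality\<close>

text \<open>Since \<open>n choose 2 - T(n) = n + ceil(n/2) - 2\<close>, more than T(n) edges means
  fewer than (3 n - 4) / 2 non-edges, whatever the parity of n; this is why everything is phrased
  through non-edges. The obstacle is to get an optimal potential with integer values: then f takes
  only the values -1, 0, 1 next to x and 0, 1, 2 next to y, and curvature becomes a problem about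
  finitely many counts. Integrality comes from combinatorics: the measures are scaled to unit
  masses, and Hall's theorem matches these along pairs on which a maximal integer potential is
  tight, so that potential and transport plan have the same value. The bounds 8 and 12 are
  arithmetic. They arise when the value -1 occurs exactly once among the vertices adjacent to x
  only: there the doubled excess over (3 n - 4) / 2 is n - 6 - 2 C1 plus further terms, C1 counting
  the common neighbours of value 1. The counts allow it to vanish for n = 8 and n = 10, but not from
  12 on.\<close>

text \<open>Induction on \<open>I\<close>, split by whether some nonempty proper subset
  \<open>X\<close> is critical, i.e. has exactly as many neighbours as elements. If so,
  \<open>X\<close> is matched into its neighbourhood \<open>U\<close> and the rest outside
  \<open>U\<close>. If not, any choice for one index can be completed.\<close>

lemma hall_marriage:
  fixes N :: "'a \<Rightarrow> 'b set"
  assumes "finite I" and "\<And>i. i \<in> I \<Longrightarrow> finite (N i)"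
    and "\<And>X. X \<subseteq> I \<Longrightarrow> card X \<le> card (\<Union>(N ` X))"
  shows "\<exists>\<sigma>. inj_on \<sigma> I \<and> (\<forall>i\<in>I. \<sigma> i \<in> N i)"
  using assms
proof (induction I arbitrary: N rule: finite_psubset_induct)
  case (psubset I)
  note fin = psubset.prems(1) and H = psubset.prems(2)
  show ?case
  proof (cases "I = {}")
    case False
    then obtain i where i: "i \<in> I" by auto
    show ?thesis
    proof (cases "\<exists>X. X \<noteq> {} \<and> X \<subset> I \<and> card X = card (\<Union>(N ` X))")
      case True
      then obtain X where X: "X \<noteq> {}" "X \<subset> I" "card X = card (\<Union>(N ` X))" by auto
      define U where "U = \<Union>(N ` X)"
      obtain f where f: "inj_on f X" "\<forall>i\<in>X. f i \<in> N i"
        using psubset.IH[OF X(2), of N] fin H X(2) by (meson psubset_imp_subset subset_trans subsetD)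
      have "\<exists>g. inj_on g (I - X) \<and> (\<forall>i\<in>I - X. g i \<in> N i - U)"
      proof (rule psubset.IH)
        show "I - X \<subset> I" using X by auto
        show "finite (N i - U)" if "i \<in> I - X" for i using that fin by auto
        fix Y assume Y: "Y \<subseteq> I - X"
        have XY: "X \<union> Y \<subseteq> I" using X Y by auto
        have fX: "finite X" "finite Y" using psubset.hyps XY finite_subset by auto
        \<comment> \<open>Hall's condition survives the deletion of \<open>U\<close>: it holds for
          \<open>X \<union> Y\<close>, and \<open>X\<close> accounts for exactly
          \<open>card U\<close> of these neighbours.\<close>
        have "card X + card Y = card (X \<union> Y)" using fX Y by (subst card_Un_disjoint) auto
        also have "\<dots> \<le> card (\<Union>(N ` (X \<union> Y)))" using H XY by blast
        also have "\<Union>(N ` (X \<union> Y)) = U \<union> \<Union>((\<lambda>i. N i - U) ` Y)" by (auto simp: U_def)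
        also have "card \<dots> \<le> card U + card (\<Union>((\<lambda>i. N i - U) ` Y))" by (rule card_Un_le)
        finally show "card Y \<le> card (\<Union>((\<lambda>i. N i - U) ` Y))" using X(3) U_def by simp
      qed
      then obtain g where g: "inj_on g (I - X)" "\<forall>i\<in>I - X. g i \<in> N i - U" by blast
      have fg: "f i \<noteq> g k" if "i \<in> X" "k \<in> I - X" for i k
      proof -
        have "f i \<in> U" using f(2) that(1) U_def by blast
        moreover have "g k \<notin> U" using g(2) that(2) by blast
        ultimately show ?thesis by metis
      qed
      have "inj_on (\<lambda>i. if i \<in> X then f i else g i) (X \<union> (I - X))"
        unfolding inj_on_Un
      proof (intro conjI)
        show "inj_on (\<lambda>i. if i \<in> X then f i else g i) X"
          using f(1) by (rule inj_on_cong[THEN iffD1, rotated]) simp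
        show "inj_on (\<lambda>i. if i \<in> X then f i else g i) (I - X)"
          using g(1) by (rule inj_on_cong[THEN iffD1, rotated]) simp
        show "(\<lambda>i. if i \<in> X then f i else g i) ` (X - (I - X)) \<inter>
            (\<lambda>i. if i \<in> X then f i else g i) ` ((I - X) - X) = {}"
          using fg by fastforce
      qed
      hence "inj_on (\<lambda>i. if i \<in> X then f i else g i) I"
        by (rule inj_on_subset) blast
      thus ?thesis using f g by (intro exI[of _ "\<lambda>i. if i \<in> X then f i else g i"]) auto
    next
      case F: False
      have "card {i} \<le> card (\<Union>(N ` {i}))" using H i by blast
      then obtain j where j: "j \<in> N i" by fastforce
      have "\<exists>g. inj_on g (I - {i}) \<and> (\<forall>k\<in>I - {i}. g k \<in> N k - {j})"
      proof (rule psubset.IH)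
        show "I - {i} \<subset> I" using i by auto
        show "finite (N k - {j})" if "k \<in> I - {i}" for k using that fin by auto
        fix Y assume Y: "Y \<subseteq> I - {i}"
        show "card Y \<le> card (\<Union>((\<lambda>k. N k - {j}) ` Y))"
        proof (cases "Y = {}")
          case False
          \<comment> \<open>No subset is critical, so \<open>Y\<close> has a spare neighbour, and
            losing \<open>j\<close> costs at most that one.\<close>
          have "card Y \<noteq> card (\<Union>(N ` Y))" using F Y i False by blast
          moreover have "card Y \<le> card (\<Union>(N ` Y))" using H[of Y] Y by blast
          moreover have "card (\<Union>(N ` Y)) - 1 \<le> card (\<Union>(N ` Y) - {j})"
            using diff_card_le_card_Diff[of "{j}" "\<Union>(N ` Y)"] by auto
          moreover have "\<Union>((\<lambda>k. N k - {j}) ` Y) = \<Union>(N ` Y) - {j}" by auto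
          ultimately show ?thesis by simp
        qed simp
      qed
      then obtain g where g: "inj_on g (I - {i})" "\<forall>k\<in>I - {i}. g k \<in> N k - {j}" by blast
      have "j \<notin> g ` (I - {i})" using g(2) by blast
      moreover have "insert i (I - {i}) = I" using i by blast
      ultimately have "inj_on (g(i := j)) I"
        using g(1) inj_on_insert[of "g(i := j)" i "I - {i}"] inj_on_fun_updI[of g "I - {i}" j i] by simp
      moreover have "\<forall>k\<in>I. (g(i := j)) k \<in> N k" using g(2) j by simp
      ultimately show ?thesis by blast
    qed
  qed simp
qed

text \<open>Take an integral 1-Lipschitz \<open>f\<close> maximizing the dual objective. If Hall's condition failed
  for the pairs of unit masses on which \<open>f\<close> is tight, lowering \<open>f\<close> by 1 on all points tightly
  reached from a violating set would preserve the Lipschitz property and increase the objective.\<close>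

lemma transport_duality:
  fixes D :: "'a \<Rightarrow> 'a \<Rightarrow> int" and m1 m2 :: "'a \<Rightarrow> nat"
  assumes fin: "finite S"
    and D0: "\<And>u v. D u v \<ge> 0" "\<And>u. D u u = 0"
    and tri: "\<And>u v w. \<lbrakk>u \<in> S; v \<in> S; w \<in> S\<rbrakk> \<Longrightarrow> D u w \<le> D u v + D v w"
    and mass: "sum m1 S = sum m2 S"
  obtains f :: "'a \<Rightarrow> int" and \<pi> :: "'a \<Rightarrow> 'a \<Rightarrow> nat"
  where "\<And>u v. \<lbrakk>u \<in> S; v \<in> S\<rbrakk> \<Longrightarrow> f v - f u \<le> D u v"
    and "\<And>u. u \<in> S \<Longrightarrow> (\<Sum>v\<in>S. \<pi> u v) = m1 u"
    and "\<And>v. v \<in> S \<Longrightarrow> (\<Sum>u\<in>S. \<pi> u v) = m2 v"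
    and "(\<Sum>u\<in>S. \<Sum>v\<in>S. D u v * int (\<pi> u v)) = (\<Sum>v\<in>S. f v * (int (m2 v) - int (m1 v)))"
proof -
  define obj where "obj f = (\<Sum>v\<in>S. f v * (int (m2 v) - int (m1 v)))" for f :: "'a \<Rightarrow> int"
  define lip where "lip f \<longleftrightarrow> (\<forall>u\<in>S. \<forall>v\<in>S. f v - f u \<le> D u v)" for f :: "'a \<Rightarrow> int"
  \<comment> \<open>The restriction to nonnegative objective makes \<open>nat (obj f)\<close>
    faithful, so that a maximum of a bounded natural-valued function can be taken; the zero function
    is admissible.\<close>
  define good where "good f \<longleftrightarrow> lip f \<and> obj f \<ge> 0" for f :: "'a \<Rightarrow> int"
  have bound: "\<exists>B. \<forall>f. lip f \<longrightarrow> obj f \<le> B"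
  proof (cases "S = {}")
    case True
    thus ?thesis by (auto simp: obj_def)
  next
    case False
    then obtain s where s: "s \<in> S" by auto
    have "obj f \<le> (\<Sum>v\<in>S. D s v * int (m2 v) + D v s * int (m1 v))" if f: "lip f" for f
    proof -
      have "obj f = (\<Sum>v\<in>S. (f v - f s) * (int (m2 v) - int (m1 v))) + f s * (\<Sum>v\<in>S. int (m2 v) - int (m1 v))"
        unfolding obj_def sum_distrib_left sum.distrib[symmetric] by (simp add: algebra_simps)
      also have "(\<Sum>v\<in>S. int (m2 v) - int (m1 v)) = 0"
        using mass by (simp add: sum_subtractf flip: of_nat_sum)
      also have "(\<Sum>v\<in>S. (f v - f s) * (int (m2 v) - int (m1 v))) \<le> (\<Sum>v\<in>S. D s v * int (m2 v) + D v s * int (m1 v))"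
      proof (rule sum_mono)
        fix v assume v: "v \<in> S"
        have "(f v - f s) * int (m2 v) \<le> D s v * int (m2 v)" "(f s - f v) * int (m1 v) \<le> D v s * int (m1 v)"
          using f v s unfolding lip_def by (auto intro!: mult_right_mono)
        thus "(f v - f s) * (int (m2 v) - int (m1 v)) \<le> D s v * int (m2 v) + D v s * int (m1 v)"
          by (simp add: algebra_simps)
      qed
      finally show ?thesis by simp
    qed
    thus ?thesis by blast
  qed
  then obtain B where B: "\<And>f. lip f \<Longrightarrow> obj f \<le> B" by blast
  have g0: "good (\<lambda>_. 0)" using D0 by (simp add: good_def lip_def obj_def)
  have gB: "\<forall>f. good f \<longrightarrow> nat (obj f) < Suc (nat B)"
    using B by (simp add: good_def nat_mono le_imp_less_Suc)
  obtain f where f: "good f" and max: "\<And>g. good g \<Longrightarrow> nat (obj g) \<le> nat (obj f)"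
    using ex_has_greatest_nat[OF g0 gB] by metis
  have fl: "f v - f u \<le> D u v" if "u \<in> S" "v \<in> S" for u v using f that by (auto simp: good_def lip_def)
  have maxi: "obj g \<le> obj f" if "lip g" for g
    using max[of g] f that unfolding good_def by (cases "obj g \<ge> 0") auto
  \<comment> \<open>Each vertex is replaced by as many labelled unit masses as its measure
    prescribes; an injection between the two families is then an integral transport plan.\<close>
  define I1 I2 where "I1 = Sigma S (\<lambda>u. {..<m1 u})" and "I2 = Sigma S (\<lambda>u. {..<m2 u})"
  have finI: "finite I1" "finite I2" using fin by (auto simp: I1_def I2_def)
  define N where "N i = {j \<in> I2. f (fst j) - f (fst i) = D (fst i) (fst j)}" for i :: "'a \<times> nat"
  have "\<exists>\<sigma>. inj_on \<sigma> I1 \<and> (\<forall>i\<in>I1. \<sigma> i \<in> N i)"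
  proof (rule hall_marriage)
    show "finite I1" "finite (N i)" for i using finI by (auto simp: N_def)
    fix X assume X: "X \<subseteq> I1"
    define U where "U = {v \<in> S. \<exists>i\<in>X. f v - f (fst i) = D (fst i) v}"
    have US: "U \<subseteq> S" "finite U" using fin by (auto simp: U_def)
    define g where "g v = (if v \<in> U then f v - 1 else f v)" for v
    have "lip g" unfolding lip_def
    proof (intro ballI)
      fix u v assume uv: "u \<in> S" "v \<in> S"
      \<comment> \<open>Tightness composes through the triangle inequality, so no tight pair leaves
        \<open>U\<close>. By integrality every leaving pair has slack at least 1, which absorbs the
        decrease of f on \<open>U\<close>.\<close>
      have "f v - f u \<le> D u v - 1" if U: "u \<in> U" "v \<notin> U"
      proof (rule ccontr)
        assume "\<not> ?thesis"
        hence e: "f v - f u = D u v" using fl[OF uv] by simp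
        obtain i where i: "i \<in> X" "f u - f (fst i) = D (fst i) u" using U(1) U_def by auto
        have iS: "fst i \<in> S" using i X by (auto simp: I1_def)
        have "f v - f (fst i) = D (fst i) v" using e i(2) tri[OF iS uv] fl[OF iS uv(2)] by simp
        hence "v \<in> U" using i uv U_def by blast
        thus False using U by simp
      qed
      thus "g v - g u \<le> D u v" using fl[OF uv] by (auto simp: g_def)
    qed
    hence "obj g \<le> obj f" by (rule maxi)
    moreover have "obj g = obj f - (\<Sum>v\<in>U. int (m2 v) - int (m1 v))"
    proof -
      have "(\<Sum>v\<in>U. int (m2 v) - int (m1 v)) = (\<Sum>v\<in>S. if v \<in> U then int (m2 v) - int (m1 v) else 0)"
        using US fin by (simp add: sum.If_cases Int_absorb1)
      thus ?thesis unfolding obj_def g_def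
        by (simp add: sum_subtractf[symmetric]) (intro sum.cong, auto simp: algebra_simps)
    qed
    ultimately have "(\<Sum>v\<in>U. int (m1 v)) \<le> (\<Sum>v\<in>U. int (m2 v))" by (simp add: sum_subtractf)
    hence le: "sum m1 U \<le> sum m2 U" by (simp flip: of_nat_sum)
    have "X \<subseteq> Sigma U (\<lambda>u. {..<m1 u})"
    proof
      fix i assume i: "i \<in> X"
      hence iS: "i \<in> I1" "fst i \<in> S" using X by (auto simp: I1_def)
      have "f (fst i) - f (fst i) = D (fst i) (fst i)" using D0(2) by simp
      hence "fst i \<in> U" using i iS U_def by blast
      thus "i \<in> Sigma U (\<lambda>u. {..<m1 u})" using iS by (auto simp: I1_def)
    qed
    hence "card X \<le> card (Sigma U (\<lambda>u. {..<m1 u}))" using US by (intro card_mono) auto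
    also have "\<dots> = sum m1 U" using US by simp
    also have "\<dots> \<le> card (Sigma U (\<lambda>u. {..<m2 u}))" using US le by simp
    \<comment> \<open>The Hall neighbourhood of \<open>X\<close> consists of all unit masses of
      \<open>m2\<close> over \<open>U\<close>, so the comparison of the two masses of
      \<open>U\<close> is Hall's condition.\<close>
    also have "Sigma U (\<lambda>u. {..<m2 u}) = \<Union>(N ` X)"
      unfolding U_def N_def I2_def by (auto intro: rev_bexI)
    finally show "card X \<le> card (\<Union>(N ` X))" .
  qed
  then obtain \<sigma> where \<sigma>: "inj_on \<sigma> I1" "\<And>i. i \<in> I1 \<Longrightarrow> \<sigma> i \<in> N i" by blast
  have sub: "\<sigma> ` I1 \<subseteq> I2" using \<sigma>(2) by (auto simp: N_def)
  have "card I1 = card I2" using fin mass by (simp add: I1_def I2_def)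
  hence img: "\<sigma> ` I1 = I2" using sub \<sigma>(1) finI by (metis card_image card_subset_eq)
  define \<pi> where "\<pi> u v = card {i \<in> {i \<in> I1. fst i = u}. fst (\<sigma> i) = v}" for u v
  have fS: "fst i \<in> S" "fst (\<sigma> i) \<in> S" if "i \<in> I1" for i
    using that \<sigma>(2)[OF that] by (auto simp: I1_def I2_def N_def)
  have tot: "(\<Sum>u\<in>S. \<Sum>v\<in>S. h u v * int (\<pi> u v)) = (\<Sum>i\<in>I1. h (fst i) (fst (\<sigma> i)))" for h
  proof -
    have "(\<Sum>v\<in>S. h u v * int (\<pi> u v)) = (\<Sum>i\<in>{i \<in> I1. fst i = u}. h (fst i) (fst (\<sigma> i)))" for u
    proof -
      have "h u v * int (\<pi> u v) = (\<Sum>i\<in>{i \<in> {i \<in> I1. fst i = u}. fst (\<sigma> i) = v}. h (fst i) (fst (\<sigma> i)))" for v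
        unfolding \<pi>_def by (simp add: mult.commute)
      thus ?thesis using finI fin fS by (simp only:) (rule sum.group, auto)
    qed
    thus ?thesis using finI fin fS by (simp only:) (rule sum.group, auto)
  qed
  show thesis
  proof (rule that[of f \<pi>])
    show "f v - f u \<le> D u v" if "u \<in> S" "v \<in> S" for u v using fl that .
    show "(\<Sum>v\<in>S. \<pi> u v) = m1 u" if u: "u \<in> S" for u
    proof -
      have "(\<Sum>v\<in>S. \<pi> u v) = card {i \<in> I1. fst i = u}"
        unfolding \<pi>_def card_eq_sum by (rule sum.group) (use finI fin fS in auto)
      also have "{i \<in> I1. fst i = u} = Pair u ` {..<m1 u}" using u by (auto simp: I1_def)
      also have "card \<dots> = m1 u" by (simp add: card_image inj_on_def)
      finally show ?thesis .
    qed
    show "(\<Sum>u\<in>S. \<pi> u v) = m2 v" if v: "v \<in> S" for v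
    proof -
      have "\<pi> u v = card {i \<in> {i \<in> I1. fst (\<sigma> i) = v}. fst i = u}" for u
        unfolding \<pi>_def by (rule arg_cong[of _ _ card]) auto
      hence "(\<Sum>u\<in>S. \<pi> u v) = card {i \<in> I1. fst (\<sigma> i) = v}"
        unfolding card_eq_sum by (simp only:) (rule sum.group, use finI fin fS in auto)
      also have "\<dots> = card (\<sigma> ` {i \<in> I1. fst (\<sigma> i) = v})"
        using \<sigma>(1) by (intro card_image[symmetric]) (auto simp: inj_on_def)
      also have "\<sigma> ` {i \<in> I1. fst (\<sigma> i) = v} = {j \<in> I2. fst j = v}" using img by blast
      also have "\<dots> = Pair v ` {..<m2 v}" using v by (auto simp: I2_def)
      also have "card \<dots> = m2 v" by (simp add: card_image inj_on_def)
      finally show ?thesis .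
    qed
    \<comment> \<open>Tightness along \<open>\<sigma>\<close> replaces each distance by a difference
      of potentials, and these sums depend only on the marginals.\<close>
    have "(\<Sum>u\<in>S. \<Sum>v\<in>S. D u v * int (\<pi> u v)) = (\<Sum>i\<in>I1. f (fst (\<sigma> i)) - f (fst i))"
      unfolding tot using \<sigma>(2) by (intro sum.cong) (auto simp: N_def)
    also have "\<dots> = (\<Sum>j\<in>I2. f (fst j)) - (\<Sum>i\<in>I1. f (fst i))"
      unfolding sum_subtractf img[symmetric] using \<sigma>(1) by (simp add: sum.reindex)
    also have "(\<Sum>j\<in>I2. f (fst j)) = (\<Sum>v\<in>S. f v * int (m2 v))"
      unfolding I2_def using fin by (subst sum.Sigma[symmetric, where g = "\<lambda>v _. f v", unfolded case_prod_unfold]) (auto simp: mult.commute)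
    also have "(\<Sum>j\<in>I1. f (fst j)) = (\<Sum>v\<in>S. f v * int (m1 v))"
      unfolding I1_def using fin by (subst sum.Sigma[symmetric, where g = "\<lambda>v _. f v", unfolded case_prod_unfold]) (auto simp: mult.commute)
    finally show "(\<Sum>u\<in>S. \<Sum>v\<in>S. D u v * int (\<pi> u v)) = (\<Sum>v\<in>S. f v * (int (m2 v) - int (m1 v)))"
      by (simp add: sum_subtractf right_diff_distrib)
  qed
qed

section \<open>Curvature as a supremum\<close>

definition nbs :: "'a pair_pre_digraph \<Rightarrow> 'a \<Rightarrow> 'a set" where
  "nbs G x = {z. (x, z) \<in> parcs G}"

context pair_graph begin

lemma nbs_simps:
  shows nbs_iff: "z \<in> nbs G x \<longleftrightarrow> (x, z) \<in> parcs G"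
    and nbs_sub: "nbs G x \<subseteq> pverts G"
    and finite_nbs: "finite (nbs G x)"
    and not_mem_nbs_self: "x \<notin> nbs G x"
    and out_degree_nbs: "out_degree (with_proj G) x = card (nbs G x)"
proof -
  show "z \<in> nbs G x \<longleftrightarrow> (x, z) \<in> parcs G" by (simp add: nbs_def)
  show sub: "nbs G x \<subseteq> pverts G" by (auto simp: nbs_def dest: in_arcsD2)
  show "finite (nbs G x)" using sub pair_finite_verts finite_subset by blast
  show "x \<notin> nbs G x" using no_loops' by (auto simp: nbs_def)
  have "out_arcs (with_proj G) x = Pair x ` nbs G x" by (auto simp: out_arcs_def nbs_def)
  thus "out_degree (with_proj G) x = card (nbs G x)"
    by (simp add: out_degree_def card_image inj_on_def)
qed

section \<open>Bounds for the graph distance and the transport distance\<close>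

lemma graph_dist_le:
  assumes "awalk u q v"
  shows "graph_dist G u v \<le> ereal (real (length q))"
proof -
  have "awalk_cost (\<lambda>_. 1) q = real (length q)"
    by (induction q) (auto simp: awalk_cost_def)
  thus ?thesis using min_cost_le_walk_cost[OF assms, of "\<lambda>_. 1"] by (simp add: graph_dist_def)
qed

lemma graph_dist_nonneg: "graph_dist G u v \<ge> 0"
  unfolding graph_dist_def \<mu>_def
  by (intro INF_greatest) (use pos_cost_pos_awalk_cost[of u _ v "\<lambda>_. 1"] in auto)

lemma graph_dist_ge:
  assumes lip: "\<And>u v. (u, v) \<in> parcs G \<Longrightarrow> f v - f u \<le> (1 :: real)"
  shows "ereal (f v - f u) \<le> graph_dist G u v"
proof -
  have "f v - f u \<le> awalk_cost (\<lambda>_. 1) q" if "awalk u q v" for q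
    using that
  proof (induction q arbitrary: u)
    case Nil
    thus ?case by (simp add: awalk_Nil_iff awalk_cost_def)
  next
    case (Cons e q)
    hence e: "e \<in> parcs G" "fst e = u" "awalk (snd e) q v" by (auto simp: awalk_Cons_iff)
    have "f v - f (snd e) \<le> awalk_cost (\<lambda>_. 1) q" using Cons.IH e(3) .
    moreover have "f (snd e) - f u \<le> 1" using lip[of u "snd e"] e(1) unfolding e(2)[symmetric] by simp
    ultimately show ?case by (simp add: awalk_cost_def)
  qed
  thus ?thesis unfolding graph_dist_def \<mu>_def by (intro INF_greatest) auto
qed

text \<open>Weak Kantorovich duality: a 1-Lipschitz f integrated against any coupling sees only the
  marginals, and \<open>f v - f u\<close> never exceeds the distance.\<close>

lemma transport_dist_ge:
  assumes lip: "\<And>u v. (u, v) \<in> parcs G \<Longrightarrow> f v - f u \<le> (1 :: real)"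
  shows "ereal ((\<Sum>v\<in>pverts G. f v * m2 v) - (\<Sum>u\<in>pverts G. f u * m1 u)) \<le> transport_dist G m1 m2"
  unfolding transport_dist_def
proof (rule INF_greatest)
  fix \<pi> assume \<pi>: "\<pi> \<in> couplings G m1 m2"
  let ?V = "pverts G"
  have "(\<Sum>v\<in>?V. f v * m2 v) = (\<Sum>v\<in>?V. \<Sum>u\<in>?V. f v * \<pi> (u, v))"
    using \<pi> by (intro sum.cong) (auto simp: couplings_def sum_distrib_left[symmetric])
  also have "\<dots> = (\<Sum>u\<in>?V. \<Sum>v\<in>?V. f v * \<pi> (u, v))" by (rule sum.swap)
  finally have "(\<Sum>v\<in>?V. f v * m2 v) - (\<Sum>u\<in>?V. f u * m1 u) = (\<Sum>u\<in>?V. \<Sum>v\<in>?V. f v * \<pi> (u, v)) - (\<Sum>u\<in>?V. \<Sum>v\<in>?V. f u * \<pi> (u, v))"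
    using \<pi> by (simp add: couplings_def sum_distrib_left[symmetric])
  also have "\<dots> = (\<Sum>u\<in>?V. \<Sum>v\<in>?V. (f v - f u) * \<pi> (u, v))"
    by (simp add: sum_subtractf left_diff_distrib)
  finally have "ereal ((\<Sum>v\<in>?V. f v * m2 v) - (\<Sum>u\<in>?V. f u * m1 u)) = (\<Sum>u\<in>?V. \<Sum>v\<in>?V. ereal (f v - f u) * ereal (\<pi> (u, v)))"
    by simp
  also have "\<dots> \<le> (\<Sum>u\<in>?V. \<Sum>v\<in>?V. graph_dist G u v * ereal (\<pi> (u, v)))"
    using \<pi> graph_dist_ge[of f, OF lip] by (intro sum_mono ereal_mult_right_mono) (auto simp: couplings_def)
  finally show "ereal ((\<Sum>v\<in>?V. f v * m2 v) - (\<Sum>u\<in>?V. f u * m1 u)) \<le> (\<Sum>u\<in>?V. \<Sum>v\<in>?V. graph_dist G u v * ereal (\<pi> (u, v)))" .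
qed

text \<open>Bounding the distance on the support of the plan is enough, because pairs without mass
  are free even at infinite distance.\<close>

lemma transport_dist_le:
  assumes \<pi>: "\<pi> \<in> couplings G m1 m2"
    and D: "\<And>u v. \<lbrakk>u \<in> pverts G; v \<in> pverts G; \<pi> (u, v) \<noteq> 0\<rbrakk> \<Longrightarrow> graph_dist G u v \<le> ereal (D u v)"
  shows "transport_dist G m1 m2 \<le> ereal (\<Sum>u\<in>pverts G. \<Sum>v\<in>pverts G. D u v * \<pi> (u, v))"
proof -
  let ?V = "pverts G"
  have "transport_dist G m1 m2 \<le> (\<Sum>u\<in>?V. \<Sum>v\<in>?V. graph_dist G u v * ereal (\<pi> (u, v)))"
    unfolding transport_dist_def using \<pi> by (rule INF_lower)
  also have "\<dots> \<le> (\<Sum>u\<in>?V. \<Sum>v\<in>?V. ereal (D u v) * ereal (\<pi> (u, v)))"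
  proof (intro sum_mono)
    fix u v assume uv: "u \<in> ?V" "v \<in> ?V"
    have p0: "\<pi> (u, v) \<ge> 0" using \<pi> uv by (auto simp: couplings_def)
    show "graph_dist G u v * ereal (\<pi> (u, v)) \<le> ereal (D u v) * ereal (\<pi> (u, v))"
    proof (cases "\<pi> (u, v) = 0")
      case True
      thus ?thesis by (simp add: zero_ereal_def[symmetric])
    next
      case False
      show ?thesis by (rule ereal_mult_right_mono) (use D uv False p0 in auto)
    qed
  qed
  finally show ?thesis by simp
qed

lemma sum_lazy_walk:
  assumes x: "x \<in> pverts G"
  shows "(\<Sum>z\<in>pverts G. f z * lazy_walk_measure G p x z) =
    p * f x + (1 - p) / card (nbs G x) * (\<Sum>z\<in>nbs G x. f z)"
proof -
  have "(\<Sum>z\<in>pverts G. f z * lazy_walk_measure G p x z) =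
      (\<Sum>z\<in>pverts G. (if z = x then p * f x else 0) + (if z \<in> nbs G x then (1 - p) / card (nbs G x) * f z else 0))"
    using not_mem_nbs_self by (intro sum.cong) (auto simp: lazy_walk_measure_def nbs_iff out_degree_nbs)
  also have "\<dots> = p * f x + (\<Sum>z\<in>pverts G \<inter> nbs G x. (1 - p) / card (nbs G x) * f z)"
    using pair_finite_verts x by (simp add: sum.distrib sum.If_cases)
  also have "pverts G \<inter> nbs G x = nbs G x" using nbs_sub by blast
  finally show ?thesis by (simp add: sum_distrib_left)
qed

end

section \<open>Monotonicity and boundedness of the curvature ratio\<close>

lemma increasing_tendsto_at_left_Sup:
  fixes g :: "real \<Rightarrow> real"
  assumes mono: "\<And>p q. \<lbrakk>0 < p; p \<le> q; q < 1\<rbrakk> \<Longrightarrow> g p \<le> g q"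
    and bdd: "\<And>p. \<lbrakk>0 < p; p < 1\<rbrakk> \<Longrightarrow> g p \<le> B"
  shows "(g \<longlongrightarrow> Sup (g ` {0<..<1})) (at_left 1)"
proof -
  have ne: "g ` {0<..<1} \<noteq> {}" by simp
  have ba: "bdd_above (g ` {0<..<1})" using bdd by (intro bdd_aboveI2[of _ _ B]) auto
  show ?thesis
  proof (rule order_tendstoI)
    fix a assume "a < Sup (g ` {0<..<1})"
    then obtain p where p: "0 < p" "p < 1" "a < g p" using less_cSup_iff[OF ne ba] by auto
    have "eventually (\<lambda>q. q \<in> {p<..<1}) (at_left (1::real))"
      using p(2) by (rule eventually_at_left_real)
    thus "eventually (\<lambda>q. a < g q) (at_left 1)"
      by eventually_elim (use p mono in \<open>force intro: less_le_trans\<close>)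
  next
    fix a assume a: "Sup (g ` {0<..<1}) < a"
    have "eventually (\<lambda>q. q \<in> {0<..<1}) (at_left (1::real))"
      by (rule eventually_at_left_real) simp
    thus "eventually (\<lambda>q. g q < a) (at_left 1)"
      by eventually_elim (use a ba in \<open>auto intro: le_less_trans[OF cSup_upper]\<close>)
  qed
qed

context pair_graph begin

lemma card_nbs_pos: "(x, y) \<in> parcs G \<Longrightarrow> card (nbs G x) > 0"
  using finite_nbs[of x] by (auto simp: card_gt_0_iff nbs_iff)

lemma lazy_walk_measure_sum:
  assumes "(x, y) \<in> parcs G"
  shows "(\<Sum>z\<in>pverts G. lazy_walk_measure G p x z) = 1"
  using sum_lazy_walk[of x "\<lambda>_. 1" p] card_nbs_pos[OF assms] in_arcsD1[OF assms] by simp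

lemma lazy_walk_measure_bounds:
  assumes "(x, y) \<in> parcs G" "0 \<le> p" "p \<le> 1"
  shows "lazy_walk_measure G p x z \<in> {0..1}"
proof -
  have "(1 - p) / card (nbs G x) \<le> (1 - p) / 1"
    using card_nbs_pos[OF assms(1)] assms by (intro divide_left_mono) auto
  thus ?thesis using assms by (auto simp: lazy_walk_measure_def out_degree_nbs)
qed

lemma lazy_walk_measure_support:
  "lazy_walk_measure G p x z \<noteq> 0 \<Longrightarrow> z = x \<or> (x, z) \<in> parcs G"
  by (auto simp: lazy_walk_measure_def split: if_splits)

lemma graph_dist_le_steps:
  assumes "u \<in> pverts G"
  shows "graph_dist G u u \<le> 0"
    and "(u, v) \<in> parcs G \<Longrightarrow> graph_dist G u v \<le> 1"
    and "(u, w) \<in> parcs G \<Longrightarrow> (w, v) \<in> parcs G \<Longrightarrow> graph_dist G u v \<le> 2"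
    and "(u, w) \<in> parcs G \<Longrightarrow> (w, w') \<in> parcs G \<Longrightarrow> (w', v) \<in> parcs G \<Longrightarrow> graph_dist G u v \<le> 3"
proof -
  show "graph_dist G u u \<le> 0"
    using graph_dist_le[of u "[]" u] assms by (simp add: awalk_Nil_iff zero_ereal_def)
  show "graph_dist G u v \<le> 1" if "(u, v) \<in> parcs G"
    using graph_dist_le[of u "[(u, v)]" v] that in_arcsD2[OF that]
    by (simp add: awalk_Cons_iff awalk_Nil_iff one_ereal_def)
  show "graph_dist G u v \<le> 2" if "(u, w) \<in> parcs G" "(w, v) \<in> parcs G"
    using graph_dist_le[of u "[(u, w), (w, v)]" v] that in_arcsD2[OF that(2)]
    by (simp add: awalk_Cons_iff awalk_Nil_iff)
  show "graph_dist G u v \<le> 3" if "(u, w) \<in> parcs G" "(w, w') \<in> parcs G" "(w', v) \<in> parcs G"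
    using graph_dist_le[of u "[(u, w), (w, w'), (w', v)]" v] that in_arcsD2[OF that(3)]
    by (simp add: awalk_Cons_iff awalk_Nil_iff)
qed

lemma graph_dist_arc_nbs:
  assumes xy: "(x, y) \<in> parcs G" and u: "u = x \<or> (x, u) \<in> parcs G" and v: "v = y \<or> (y, v) \<in> parcs G"
  shows "graph_dist G u v \<le> 3"
proof -
  have uV: "u \<in> pverts G" using u xy by (auto dest: in_arcsD1 in_arcsD2)
  have le: "(1::ereal) \<le> 3" "(2::ereal) \<le> 3" by (auto simp: one_ereal_def)
  have "u = x \<or> (u, x) \<in> parcs G" using u arcs_symmetric by blast
  thus ?thesis using graph_dist_le_steps(2-4)[OF uV] v xy le by (metis order_trans)
qed

text \<open>The product coupling charges only pairs joined through the edge \<open>xy\<close> by a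
  walk of length at most 3, so its cost is finite.\<close>

lemma transport_dist_lazy_finite:
  assumes xy: "(x, y) \<in> parcs G" and p: "0 \<le> p" "p \<le> 1"
  obtains w where "transport_dist G (lazy_walk_measure G p x) (lazy_walk_measure G p y) = ereal w"
proof -
  let ?m1 = "lazy_walk_measure G p x" and ?m2 = "lazy_walk_measure G p y"
  have yx: "(y, x) \<in> parcs G" using xy arcs_symmetric by blast
  have b: "0 \<le> ?m1 u" "?m1 u \<le> 1" "0 \<le> ?m2 u" "?m2 u \<le> 1" for u
    using lazy_walk_measure_bounds[OF xy p, of u] lazy_walk_measure_bounds[OF yx p, of u] by auto
  have "(\<lambda>(u, v). ?m1 u * ?m2 v) \<in> couplings G ?m1 ?m2"
    using b lazy_walk_measure_sum[OF xy, of p] lazy_walk_measure_sum[OF yx, of p]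
    by (auto simp: couplings_def sum_distrib_left[symmetric] sum_distrib_right[symmetric] intro: mult_le_one)
  hence "transport_dist G ?m1 ?m2 \<le> ereal (\<Sum>u\<in>pverts G. \<Sum>v\<in>pverts G. 3 * (\<lambda>(u, v). ?m1 u * ?m2 v) (u, v))"
  proof (rule transport_dist_le)
    fix u v assume "(\<lambda>(u, v). ?m1 u * ?m2 v) (u, v) \<noteq> 0"
    hence "u = x \<or> (x, u) \<in> parcs G" "v = y \<or> (y, v) \<in> parcs G"
      using lazy_walk_measure_support by auto
    thus "graph_dist G u v \<le> ereal 3" using graph_dist_arc_nbs[OF xy] by simp
  qed
  moreover have "0 \<le> transport_dist G ?m1 ?m2" using transport_dist_ge[of "\<lambda>_. 0"] by (simp add: zero_ereal_def)
  ultimately obtain w where "transport_dist G ?m1 ?m2 = ereal w"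
    by (cases "transport_dist G ?m1 ?m2") auto
  thus thesis by (rule that)
qed

text \<open>The measure of idleness \<open>q\<close> is a mixture of the one of idleness \<open>p\<close> and the point mass, so a
  coupling for \<open>p\<close> can be mixed with the transport of all mass along the edge.\<close>

lemma kappa_ratio_mono:
  assumes xy: "(x, y) \<in> parcs G" and p: "0 < p" "p \<le> q" "q < 1"
  shows "kappa G p x y / (1 - p) \<le> kappa G q x y / (1 - q)"
proof -
  define m where "m p z = lazy_walk_measure G p z" for p z
  have V: "x \<in> pverts G" "y \<in> pverts G" using xy in_arcsD1 in_arcsD2 by auto
  let ?V = "pverts G"
  have fV: "finite ?V" by (rule pair_finite_verts)
  obtain wp where wp: "transport_dist G (m p x) (m p y) = ereal wp"
    using transport_dist_lazy_finite[OF xy, of p] p by (auto simp: m_def)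
  obtain wq where wq: "transport_dist G (m q x) (m q y) = ereal wq"
    using transport_dist_lazy_finite[OF xy, of q] p by (auto simp: m_def)
  \<comment> \<open>This weight makes the measure of idleness q equal to l times the one of idleness
    p plus 1 - l times the point mass. The claim is then W_q \<le> l W_p + (1 - l), as the point
    masses are at distance at most 1.\<close>
  define l where "l = (1 - q) / (1 - p)"
  have l: "0 < l" "l \<le> 1" "1 - q = l * (1 - p)" using p by (auto simp: l_def)
  have mix: "m q z u = l * m p z u + (1 - l) * (if u = z then 1 else 0)" for z u
    using l(3) by (auto simp: m_def lazy_walk_measure_def algebra_simps)
  have "ereal ((wq - (1 - l)) / l) \<le> transport_dist G (m p x) (m p y)"
    unfolding transport_dist_def
  proof (rule INF_greatest)
    fix \<pi> assume \<pi>: "\<pi> \<in> couplings G (m p x) (m p y)"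
    have p01: "0 \<le> \<pi> (u, v)" "\<pi> (u, v) \<le> 1" if "u \<in> ?V" "v \<in> ?V" for u v
      using \<pi> that by (auto simp: couplings_def)
    let ?C = "\<Sum>u\<in>?V. \<Sum>v\<in>?V. graph_dist G u v * ereal (\<pi> (u, v))"
    show "ereal ((wq - (1 - l)) / l) \<le> ?C"
    proof (cases "\<exists>u\<in>?V. \<exists>v\<in>?V. \<pi> (u, v) \<noteq> 0 \<and> graph_dist G u v = \<infinity>")
      case True
      then obtain u v where uv: "u \<in> ?V" "v \<in> ?V" "\<pi> (u, v) \<noteq> 0" "graph_dist G u v = \<infinity>" by blast
      have inf: "graph_dist G u v * ereal (\<pi> (u, v)) = \<infinity>" using uv p01[OF uv(1,2)] by simp
      have "(\<Sum>v\<in>?V. graph_dist G u v * ereal (\<pi> (u, v))) = \<infinity>"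
        unfolding sum_Pinfty using inf uv fV by blast
      hence "?C = \<infinity>" unfolding sum_Pinfty using uv fV by blast
      thus ?thesis by simp
    next
      case False
      define D where "D u v = real_of_ereal (graph_dist G u v)" for u v
      have D: "graph_dist G u v = ereal (D u v)" if "u \<in> ?V" "v \<in> ?V" "\<pi> (u, v) \<noteq> 0" for u v
        using False that graph_dist_nonneg[of u v] by (cases "graph_dist G u v") (auto simp: D_def)
      define \<pi>' where "\<pi>' = (\<lambda>(u, v). l * \<pi> (u, v) + (1 - l) * (if u = x \<and> v = y then 1 else 0))"
      have C: "?C = ereal (\<Sum>u\<in>?V. \<Sum>v\<in>?V. D u v * \<pi> (u, v))"
      proof -
        have "graph_dist G u v * ereal (\<pi> (u, v)) = ereal (D u v * \<pi> (u, v))" if "u \<in> ?V" "v \<in> ?V" for u v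
          using D[OF that] by (cases "\<pi> (u, v) = 0") (auto simp: zero_ereal_def[symmetric])
        thus ?thesis by simp
      qed
      have dxy: "graph_dist G x y \<le> 1" using graph_dist_le_steps(2)[OF V(1) xy] .
      hence Dxy: "D x y \<le> 1" using graph_dist_nonneg[of x y] by (cases "graph_dist G x y") (auto simp: D_def one_ereal_def)
      have Dxy': "graph_dist G x y = ereal (D x y)"
        using dxy graph_dist_nonneg[of x y] by (cases "graph_dist G x y") (auto simp: D_def)
      have "\<pi>' \<in> couplings G (m q x) (m q y)"
        unfolding couplings_def
      proof (intro CollectI conjI ballI)
        fix u v assume "u \<in> ?V" "v \<in> ?V"
        hence "0 \<le> l * \<pi> (u, v)" "l * \<pi> (u, v) \<le> l" "l * \<pi> (u, v) \<le> 1" using mult_le_one[of l "\<pi> (u, v)"] p01[of u v] l by (auto intro: mult_left_le)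
        thus "\<pi>' (u, v) \<in> {0..1}" using l by (auto simp: \<pi>'_def)
      next
        fix u assume u: "u \<in> ?V"
        have "(\<Sum>v\<in>?V. \<pi>' (u, v)) = l * (\<Sum>v\<in>?V. \<pi> (u, v)) + (1 - l) * (\<Sum>v\<in>?V. if u = x \<and> v = y then 1 else 0)"
          by (simp add: \<pi>'_def sum.distrib sum_distrib_left)
        also have "(\<Sum>v\<in>?V. if u = x \<and> v = y then 1 else (0::real)) = (if u = x then 1 else 0)"
          using fV V by simp
        finally show "(\<Sum>v\<in>?V. \<pi>' (u, v)) = m q x u" using \<pi> u by (simp add: couplings_def mix)
      next
        fix v assume v: "v \<in> ?V"
        have "(\<Sum>u\<in>?V. \<pi>' (u, v)) = l * (\<Sum>u\<in>?V. \<pi> (u, v)) + (1 - l) * (\<Sum>u\<in>?V. if u = x \<and> v = y then 1 else 0)"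
          by (simp add: \<pi>'_def sum.distrib sum_distrib_left)
        also have "(\<Sum>u\<in>?V. if u = x \<and> v = y then 1 else (0::real)) = (if v = y then 1 else 0)"
          using fV V by simp
        finally show "(\<Sum>u\<in>?V. \<pi>' (u, v)) = m q y v" using \<pi> v by (simp add: couplings_def mix)
      qed
      hence "transport_dist G (m q x) (m q y) \<le> ereal (\<Sum>u\<in>?V. \<Sum>v\<in>?V. D u v * \<pi>' (u, v))"
      proof (rule transport_dist_le)
        fix u v assume uv: "u \<in> ?V" "v \<in> ?V" "\<pi>' (u, v) \<noteq> 0"
        show "graph_dist G u v \<le> ereal (D u v)"
        proof (cases "u = x \<and> v = y")
          case True
          thus ?thesis using Dxy' by simp
        next
          case False
          hence "\<pi> (u, v) \<noteq> 0" using uv(3) by (auto simp: \<pi>'_def)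
          thus ?thesis using D[OF uv(1,2)] by simp
        qed
      qed
      hence "wq \<le> (\<Sum>u\<in>?V. \<Sum>v\<in>?V. D u v * \<pi>' (u, v))" using wq by simp
      also have "\<dots> \<le> l * (\<Sum>u\<in>?V. \<Sum>v\<in>?V. D u v * \<pi> (u, v)) + (1 - l)"
      proof -
        have "D u v * \<pi>' (u, v) = l * (D u v * \<pi> (u, v)) + (if v = y then if u = x then (1 - l) * D x y else 0 else 0)" for u v
          by (simp add: \<pi>'_def algebra_simps)
        hence "(\<Sum>u\<in>?V. \<Sum>v\<in>?V. D u v * \<pi>' (u, v)) = l * (\<Sum>u\<in>?V. \<Sum>v\<in>?V. D u v * \<pi> (u, v)) + (1 - l) * D x y"
          using fV V by (simp add: sum.distrib sum_distrib_left)
        moreover have "(1 - l) * D x y \<le> (1 - l) * 1" using Dxy l by (intro mult_left_mono) auto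
        ultimately show ?thesis by simp
      qed
      finally show ?thesis unfolding C using l by (simp add: field_simps)
    qed
  qed
  hence "wq - (1 - l) \<le> l * wp" unfolding wp using l by (simp add: field_simps)
  hence "l * (1 - wp) \<le> 1 - wq" by (simp add: algebra_simps)
  hence "l * (1 - wp) / (1 - q) \<le> (1 - wq) / (1 - q)" using p by (intro divide_right_mono) auto
  moreover have "l * (1 - wp) / (1 - q) = (1 - wp) / (1 - p)" unfolding l(3) using l p by simp
  ultimately show ?thesis using wp wq by (simp add: kappa_def m_def)
qed

text \<open>The function that is 0 at x and 1 elsewhere is 1-Lipschitz and gives W \<ge> p - (1 -
  p), hence a curvature of at most 2 (1 - p).\<close>

lemma kappa_ratio_le:
  assumes xy: "(x, y) \<in> parcs G" and p: "0 < p" "p < 1"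
  shows "kappa G p x y / (1 - p) \<le> 2"
proof -
  have V: "x \<in> pverts G" "y \<in> pverts G" using xy in_arcsD1 in_arcsD2 by auto
  let ?m1 = "lazy_walk_measure G p x" and ?m2 = "lazy_walk_measure G p y"
  obtain w where w: "transport_dist G ?m1 ?m2 = ereal w"
    using transport_dist_lazy_finite[OF xy, of p] p by auto
  define f :: "'a \<Rightarrow> real" where "f v = (if v = x then 0 else 1)" for v
  have "ereal ((\<Sum>v\<in>pverts G. f v * ?m2 v) - (\<Sum>u\<in>pverts G. f u * ?m1 u)) \<le> transport_dist G ?m1 ?m2"
    by (rule transport_dist_ge) (auto simp: f_def)
  moreover have "(\<Sum>v\<in>pverts G. f v * ?m2 v) \<ge> p"
  proof -
    have "x \<noteq> y" using xy no_loops' by blast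
    moreover have "(\<Sum>z\<in>nbs G y. f z) \<ge> 0" by (intro sum_nonneg) (auto simp: f_def)
    ultimately show ?thesis using p unfolding sum_lazy_walk[OF V(2)] by (simp add: f_def)
  qed
  moreover have "(\<Sum>u\<in>pverts G. f u * ?m1 u) = 1 - p"
  proof -
    have "(\<Sum>z\<in>nbs G x. f z) = (\<Sum>z\<in>nbs G x. 1)"
      using not_mem_nbs_self[of x] by (intro sum.cong) (auto simp: f_def)
    thus ?thesis using card_nbs_pos[OF xy] unfolding sum_lazy_walk[OF V(1)] by (simp add: f_def)
  qed
  ultimately have "w \<ge> p - (1 - p)" unfolding w by simp
  thus ?thesis using p w by (simp add: kappa_def divide_le_eq)
qed

lemma kappa_LLY_eq_Sup:
  assumes "(x, y) \<in> parcs G"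
  shows "kappa_LLY G x y = Sup ((\<lambda>p. kappa G p x y / (1 - p)) ` {0<..<1})"
  unfolding kappa_LLY_def
  by (intro tendsto_Lim increasing_tendsto_at_left_Sup[where B = 2] kappa_ratio_mono[OF assms] kappa_ratio_le[OF assms])
    auto

lemma kappa_LLY_nonpos_iff:
  assumes xy: "(x, y) \<in> parcs G"
  shows "kappa_LLY G x y \<le> 0 \<longleftrightarrow>
    (\<forall>p\<in>{0<..<1}. transport_dist G (lazy_walk_measure G p x) (lazy_walk_measure G p y) \<ge> 1)"
proof -
  have "bdd_above ((\<lambda>p. kappa G p x y / (1 - p)) ` {0<..<1})"
    using kappa_ratio_le[OF xy] by (intro bdd_aboveI2[of _ _ 2]) auto
  hence "kappa_LLY G x y \<le> 0 \<longleftrightarrow> (\<forall>p\<in>{0<..<1}. kappa G p x y / (1 - p) \<le> 0)"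
    unfolding kappa_LLY_eq_Sup[OF xy] by (subst cSup_le_iff) auto
  also have "\<dots> \<longleftrightarrow> (\<forall>p\<in>{0<..<1}. transport_dist G (lazy_walk_measure G p x) (lazy_walk_measure G p y) \<ge> 1)"
  proof (intro ball_cong refl)
    fix p :: real assume p: "p \<in> {0<..<1}"
    obtain w where w: "transport_dist G (lazy_walk_measure G p x) (lazy_walk_measure G p y) = ereal w"
      using transport_dist_lazy_finite[OF xy, of p] p by auto
    thus "kappa G p x y / (1 - p) \<le> 0 \<longleftrightarrow> transport_dist G (lazy_walk_measure G p x) (lazy_walk_measure G p y) \<ge> 1"
      using p by (simp add: kappa_def divide_le_0_iff one_ereal_def)
  qed
  finally show ?thesis .
qed

text \<open>An upper bound for the distance from a neighbour of \<open>x\<close> to a neighbour of \<open>y\<close>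
  when \<open>xy\<close> is an edge; unlike the graph distance it is always finite.\<close>

definition dist3 :: "'a \<Rightarrow> 'a \<Rightarrow> int" where
  "dist3 u v = (if u = v then 0 else if (u, v) \<in> parcs G then 1
     else if \<exists>w. (u, w) \<in> parcs G \<and> (w, v) \<in> parcs G then 2 else 3)"

text \<open>Because of the cap at 3 only sums below 3 matter: either one summand is 0, or both are 1
  and \<open>v\<close> itself is the middle vertex.\<close>

lemma dist3_triangle: "dist3 u w \<le> dist3 u v + dist3 v w"
proof (cases "dist3 u v + dist3 v w \<ge> 3")
  case True
  moreover have "dist3 u w \<le> 3" by (simp add: dist3_def)
  ultimately show ?thesis by simp
next
  case False
  then consider "u = v" | "v = w" | "(u, v) \<in> parcs G" "(v, w) \<in> parcs G"
    by (auto simp: dist3_def split: if_splits)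
  thus ?thesis by cases (auto simp: dist3_def)
qed

text \<open>The idleness \<open>p = 3/4\<close> suffices, and multiplying by \<open>4 d\<^sub>x d\<^sub>y\<close> makes both measures
  integral. The last assumption of the witness states that the average of \<open>f\<close> over the neighbours
  of \<open>y\<close> exceeds the one over the neighbours of \<open>x\<close> by at least 1.\<close>

lemma lipschitz_witness:
  assumes xy: "(x, y) \<in> parcs G" and nonpos: "kappa_LLY G x y \<le> 0"
  obtains f :: "'a \<Rightarrow> int" where "f x = 0" "f y = 1"
    and "\<And>u v. \<lbrakk>u \<in> nbs G x \<union> nbs G y; v \<in> nbs G x \<union> nbs G y; (u, v) \<in> parcs G\<rbrakk> \<Longrightarrow> f v - f u \<le> 1"
    and "int (card (nbs G x)) * int (card (nbs G y)) + int (card (nbs G y)) * (\<Sum>z\<in>nbs G x. f z)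
      \<le> int (card (nbs G x)) * (\<Sum>z\<in>nbs G y. f z)"
proof -
  have yx: "(y, x) \<in> parcs G" using xy arcs_symmetric by blast
  have V: "x \<in> pverts G" "y \<in> pverts G" using xy in_arcsD1 in_arcsD2 by auto
  let ?V = "pverts G"
  define X Y S a b where "X = nbs G x" and "Y = nbs G y" and "S = X \<union> Y" and "a = card X" and "b = card Y"
  have mem: "y \<in> X" "x \<in> Y" "x \<notin> X" "y \<notin> Y" using xy yx not_mem_nbs_self by (auto simp: X_def Y_def nbs_iff)
  have fin: "finite X" "finite Y" "finite S" "finite ?V" using finite_nbs pair_finite_verts by (auto simp: X_def Y_def S_def)
  have SV: "S \<subseteq> ?V" using nbs_sub by (auto simp: S_def X_def Y_def)
  have xS: "x \<in> S" "y \<in> S" using mem by (auto simp: S_def)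
  have ab: "a > 0" "b > 0" using card_nbs_pos[OF xy] card_nbs_pos[OF yx] by (auto simp: a_def b_def X_def Y_def)
  define m1 where "m1 z = (if z = x then 3 * a * b else if z \<in> X then b else 0)" for z
  define m2 where "m2 z = (if z = y then 3 * a * b else if z \<in> Y then a else 0)" for z
  have lazy1: "lazy_walk_measure G (3/4) x z = real (m1 z) / (4 * a * b)" for z
    using ab by (auto simp: lazy_walk_measure_def m1_def out_degree_nbs nbs_iff X_def a_def field_simps)
  have lazy2: "lazy_walk_measure G (3/4) y z = real (m2 z) / (4 * a * b)" for z
    using ab by (auto simp: lazy_walk_measure_def m2_def out_degree_nbs nbs_iff Y_def b_def field_simps)
  have sum1: "(\<Sum>z\<in>S. h z * int (m1 z)) = h x * (3 * int a * int b) + int b * (\<Sum>z\<in>X. h z)" for h :: "'a \<Rightarrow> int"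
  proof -
    have "(\<Sum>z\<in>S. h z * int (m1 z)) = (\<Sum>z\<in>S. (if z = x then h x * (3 * int a * int b) else 0) + (if z \<in> X then int b * h z else 0))"
      using mem by (intro sum.cong) (auto simp: m1_def)
    also have "\<dots> = h x * (3 * int a * int b) + (\<Sum>z\<in>S \<inter> X. int b * h z)"
      using fin xS by (simp add: sum.distrib sum.If_cases)
    also have "S \<inter> X = X" by (auto simp: S_def)
    finally show ?thesis by (simp add: sum_distrib_left)
  qed
  have sum2: "(\<Sum>z\<in>S. h z * int (m2 z)) = h y * (3 * int a * int b) + int a * (\<Sum>z\<in>Y. h z)" for h :: "'a \<Rightarrow> int"
  proof -
    have "(\<Sum>z\<in>S. h z * int (m2 z)) = (\<Sum>z\<in>S. (if z = y then h y * (3 * int a * int b) else 0) + (if z \<in> Y then int a * h z else 0))"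
      using mem by (intro sum.cong) (auto simp: m2_def)
    also have "\<dots> = h y * (3 * int a * int b) + (\<Sum>z\<in>S \<inter> Y. int a * h z)"
      using fin xS by (simp add: sum.distrib sum.If_cases)
    also have "S \<inter> Y = Y" by (auto simp: S_def)
    finally show ?thesis by (simp add: sum_distrib_left)
  qed
  have "int (sum m1 S) = int (sum m2 S)"
    using sum1[of "\<lambda>_. 1"] sum2[of "\<lambda>_. 1"] by (simp add: a_def b_def)
  hence mass: "sum m1 S = sum m2 S" by (simp only: of_nat_eq_iff)
  obtain g \<pi> where g: "\<And>u v. \<lbrakk>u \<in> S; v \<in> S\<rbrakk> \<Longrightarrow> g v - g u \<le> dist3 u v"
    and \<pi>1: "\<And>u. u \<in> S \<Longrightarrow> (\<Sum>v\<in>S. \<pi> u v) = m1 u"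
    and \<pi>2: "\<And>v. v \<in> S \<Longrightarrow> (\<Sum>u\<in>S. \<pi> u v) = m2 v"
    and cost: "(\<Sum>u\<in>S. \<Sum>v\<in>S. dist3 u v * int (\<pi> u v)) = (\<Sum>v\<in>S. g v * (int (m2 v) - int (m1 v)))"
    by (rule transport_duality[of S dist3 m1 m2]) (use fin mass dist3_triangle in \<open>auto simp: dist3_def\<close>)
  define \<rho> where "\<rho> = (\<lambda>(u, v). if u \<in> S \<and> v \<in> S then real (\<pi> u v) / (4 * a * b) else 0)"
  have extend: "(\<Sum>v\<in>?V. if v \<in> S then h v else 0) = (\<Sum>v\<in>S. h v)" for h :: "'a \<Rightarrow> real"
    using SV fin by (simp add: sum.If_cases Int_absorb1)
  have m0: "m1 u = 0" "m2 u = 0" if "u \<notin> S" for u using that xS by (auto simp: m1_def m2_def S_def)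
  have "(\<Sum>v\<in>?V. \<rho> (u, v)) = lazy_walk_measure G (3/4) x u" for u
  proof (cases "u \<in> S")
    case True
    hence "(\<Sum>v\<in>?V. \<rho> (u, v)) = (\<Sum>v\<in>S. real (\<pi> u v)) / (4 * a * b)"
      by (simp add: \<rho>_def extend sum_divide_distrib)
    also have "(\<Sum>v\<in>S. real (\<pi> u v)) = real (m1 u)" using \<pi>1[OF True] by (simp flip: of_nat_sum)
    finally show ?thesis by (simp add: lazy1)
  qed (simp add: \<rho>_def lazy1 m0)
  moreover have "(\<Sum>u\<in>?V. \<rho> (u, v)) = lazy_walk_measure G (3/4) y v" for v
  proof (cases "v \<in> S")
    case True
    hence "(\<Sum>u\<in>?V. \<rho> (u, v)) = (\<Sum>u\<in>S. real (\<pi> u v)) / (4 * a * b)"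
      by (simp add: \<rho>_def extend sum_divide_distrib)
    also have "(\<Sum>u\<in>S. real (\<pi> u v)) = real (m2 v)" using \<pi>2[OF True] by (simp flip: of_nat_sum)
    finally show ?thesis by (simp add: lazy2)
  qed (simp add: \<rho>_def lazy2 m0)
  moreover have "\<rho> (u, v) \<in> {0..1}" for u v
  proof -
    have "real (\<pi> u v) / (4 * a * b) \<le> 1" if "u \<in> S" "v \<in> S"
    proof -
      have "int (sum m1 S) = int (4 * a * b)" using sum1[of "\<lambda>_. 1"] by (simp add: a_def)
      hence tot: "sum m1 S = 4 * a * b" by (simp only: of_nat_eq_iff)
      have "\<pi> u v \<le> m1 u" using \<pi>1[OF that(1)] member_le_sum[of v S "\<pi> u"] that fin by simp
      also have "\<dots> \<le> sum m1 S" using that fin by (intro member_le_sum) auto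
      also note tot
      finally show ?thesis using ab by (simp add: divide_le_eq flip: of_nat_mult)
    qed
    thus ?thesis by (auto simp: \<rho>_def)
  qed
  ultimately have "\<rho> \<in> couplings G (lazy_walk_measure G (3/4) x) (lazy_walk_measure G (3/4) y)"
    by (simp add: couplings_def)
  hence "transport_dist G (lazy_walk_measure G (3/4) x) (lazy_walk_measure G (3/4) y) \<le>
      ereal (\<Sum>u\<in>?V. \<Sum>v\<in>?V. real_of_int (dist3 u v) * \<rho> (u, v))"
  proof (rule transport_dist_le)
    fix u v assume u: "u \<in> ?V" and "\<rho> (u, v) \<noteq> 0"
    hence uv: "u \<in> S" "v \<in> S" "\<pi> u v \<noteq> 0" by (auto simp: \<rho>_def split: if_splits)
    \<comment> \<open>A pair carrying mass has both marginals positive, so it consists of x or a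
      neighbour of x and of y or a neighbour of y. On such pairs the cap at 3 does not underestimate
      the distance.\<close>
    hence "(\<Sum>v\<in>S. \<pi> u v) \<noteq> 0" "(\<Sum>u\<in>S. \<pi> u v) \<noteq> 0" using fin by auto
    hence "m1 u \<noteq> 0" "m2 v \<noteq> 0" using \<pi>1 \<pi>2 uv by auto
    hence "graph_dist G u v \<le> 3"
      by (intro graph_dist_arc_nbs[OF xy]) (auto simp: m1_def m2_def X_def Y_def nbs_iff split: if_splits)
    thus "graph_dist G u v \<le> ereal (real_of_int (dist3 u v))"
      using graph_dist_le_steps[OF u] by (auto simp: dist3_def simp flip: zero_ereal_def one_ereal_def)
  qed
  moreover have "transport_dist G (lazy_walk_measure G (3/4) x) (lazy_walk_measure G (3/4) y) \<ge> 1"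
    using nonpos kappa_LLY_nonpos_iff[OF xy] by simp
  ultimately have "ereal 1 \<le> ereal (\<Sum>u\<in>?V. \<Sum>v\<in>?V. real_of_int (dist3 u v) * \<rho> (u, v))"
    unfolding one_ereal_def by (rule order_trans[rotated])
  hence "1 \<le> (\<Sum>u\<in>?V. \<Sum>v\<in>?V. real_of_int (dist3 u v) * \<rho> (u, v))" by simp
  also have "\<dots> = (\<Sum>u\<in>?V. if u \<in> S then (\<Sum>v\<in>?V. if v \<in> S then real_of_int (dist3 u v) * \<pi> u v / (4 * a * b) else 0) else 0)"
    by (intro sum.cong refl) (auto simp: \<rho>_def intro!: sum.cong)
  also have "\<dots> = (\<Sum>u\<in>S. \<Sum>v\<in>S. real_of_int (dist3 u v) * \<pi> u v) / (4 * a * b)"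
    by (simp only: extend sum_divide_distrib)
  also have "(\<Sum>u\<in>S. \<Sum>v\<in>S. real_of_int (dist3 u v) * \<pi> u v) = real_of_int (\<Sum>u\<in>S. \<Sum>v\<in>S. dist3 u v * int (\<pi> u v))"
    by simp
  finally have "real_of_int (4 * a * b) \<le> real_of_int (\<Sum>u\<in>S. \<Sum>v\<in>S. dist3 u v * int (\<pi> u v))"
    using ab by (simp add: le_divide_eq)
  hence "4 * int a * int b \<le> (\<Sum>v\<in>S. g v * (int (m2 v) - int (m1 v)))"
    unfolding cost of_int_le_iff by simp
  \<comment> \<open>Equal total masses make the objective invariant under adding constants, so the
    potential may be normalized to vanish at x.\<close>
  also have "\<dots> = (\<Sum>v\<in>S. (g v - g x) * (int (m2 v) - int (m1 v))) + g x * ((\<Sum>v\<in>S. int (m2 v)) - (\<Sum>v\<in>S. int (m1 v)))"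
    by (simp add: sum_subtractf sum_distrib_left sum.distrib left_diff_distrib right_diff_distrib)
  also have "(\<Sum>v\<in>S. int (m2 v)) - (\<Sum>v\<in>S. int (m1 v)) = 0" using mass by (simp flip: of_nat_sum)
  finally have obj: "4 * int a * int b \<le> (\<Sum>v\<in>S. (g v - g x) * int (m2 v)) - (\<Sum>v\<in>S. (g v - g x) * int (m1 v))"
    by (simp add: right_diff_distrib sum_subtractf)
  define f where "f v = g v - g x" for v
  have fx: "f x = 0" by (simp add: f_def)
  have lip: "f v - f u \<le> 1" if "u \<in> S" "v \<in> S" "(u, v) \<in> parcs G" for u v
    using g[OF that(1,2)] that(3) no_loops' by (auto simp: f_def dist3_def)
  have key: "4 * int a * int b \<le> f y * (3 * int a * int b) + int a * (\<Sum>z\<in>Y. f z) - int b * (\<Sum>z\<in>X. f z)"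
    using obj unfolding f_def[symmetric] sum1 sum2 fx by (simp add: mult.assoc)
  have fy1: "f y \<le> 1" using lip[OF xS xy] fx by simp
  have X1: "(\<Sum>z\<in>X. f z) \<ge> - int a"
  proof -
    have "(\<Sum>z\<in>X. f z) \<ge> (\<Sum>z\<in>X. -1)"
    proof (rule sum_mono)
      fix z assume z: "z \<in> X"
      hence "(z, x) \<in> parcs G" using arcs_symmetric by (auto simp: X_def nbs_iff)
      thus "-1 \<le> f z" using lip[of z x] xS z fx by (auto simp: S_def)
    qed
    thus ?thesis by (simp add: a_def)
  qed
  \<comment> \<open>An idleness above 1/2 is what works here: with f y \<le> 0 the values are at
    most 1 on \<open>Y\<close> and at least -1 on \<open>X\<close>, so the objective is at most 2 a
    b, short of the required 4 a b.\<close>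
  have "f y = 1"
  proof (rule ccontr)
    assume "f y \<noteq> 1"
    hence fy: "f y \<le> 0" using fy1 by simp
    have "(\<Sum>z\<in>Y. f z) \<le> (\<Sum>z\<in>Y. 1)"
    proof (rule sum_mono)
      fix z assume z: "z \<in> Y"
      thus "f z \<le> 1" using lip[of y z] xS fy by (auto simp: S_def Y_def nbs_iff)
    qed
    hence "int a * (\<Sum>z\<in>Y. f z) \<le> int a * int b" by (intro mult_left_mono) (auto simp: b_def)
    moreover have "int b * (- int a) \<le> int b * (\<Sum>z\<in>X. f z)" using X1 by (intro mult_left_mono) auto
    moreover have "f y * (3 * int a * int b) \<le> 0" using fy by (simp add: mult_nonpos_nonneg)
    moreover have "int a * int b > 0" using ab by simp
    ultimately show False using key by (simp add: mult.commute)
  qed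
  show thesis
  proof (rule that[of f])
    show "int (card (nbs G x)) * int (card (nbs G y)) + int (card (nbs G y)) * (\<Sum>z\<in>nbs G x. f z)
      \<le> int (card (nbs G x)) * (\<Sum>z\<in>nbs G y. f z)"
      using key \<open>f y = 1\<close> by (simp add: X_def Y_def a_def b_def)
  qed (use fx \<open>f y = 1\<close> lip in \<open>auto simp: S_def X_def Y_def\<close>)
qed

end

section \<open>Counting non-edges\<close>

text \<open>Let \<open>f\<close> be the Lipschitz function certifying nonpositive curvature of \<open>xy\<close>, with \<open>f x = 0\<close>
  and \<open>f y = 1\<close>. In the following inequalities \<open>\<alpha>\<close>, \<open>A0\<close>, \<open>A1\<close> count the vertices adjacent to \<open>x\<close>
  only on which \<open>f\<close> is \<open>-1\<close>, \<open>0\<close>, \<open>1\<close>; \<open>B0\<close>, \<open>B1\<close>, \<open>\<beta>\<close> count those adjacent to \<open>y\<close> only on which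
  \<open>f\<close> is \<open>0\<close>, \<open>1\<close>, \<open>2\<close>; \<open>C0\<close>, \<open>C1\<close> count the common neighbours by the value of \<open>f\<close>; and \<open>r\<close> counts
  the remaining vertices. \<open>Q\<close> is \<open>2 m - (3 n - 4)\<close>, where \<open>m\<close> is the number of non-edges forced
  by \<open>f\<close>, and \<open>cond\<close> is the certificate inequality between the averages of \<open>f\<close>. By the symmetry
  exchanging \<open>x\<close> with \<open>y\<close> and \<open>f\<close> with \<open>1 - f\<close> one may assume \<open>\<alpha> \<le> \<beta>\<close>.\<close>

lemma excess_alpha_zero:
  fixes A0 A1 C0 C1 B0 B1 \<beta> r :: int
  assumes nn: "A0 \<ge> 0" "A1 \<ge> 0" "C0 \<ge> 0" "C1 \<ge> 0" "B0 \<ge> 0" "B1 \<ge> 0" "\<beta> \<ge> 0" "r \<ge> 0"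
    and cond: "(1 + C0 + C1 + B0 + B1 + \<beta>) * (1 + C1 + A1) \<le> (1 + C0 + C1 + A0 + A1) * (\<beta> - 1 - C0 - B0)"
    and Q: "Q = 2 * \<beta> * (A0 + C0 + B0) - (A0 + A1 + B0 + B1 + \<beta>) - 3 * (C0 + C1) + r - 2"
  shows "Q \<ge> 0" and "Q = 0 \<Longrightarrow> A0 = 1 \<and> A1 = 0 \<and> C0 = 0 \<and> C1 = 0 \<and> B0 = 0 \<and> r = 0 \<and> \<beta> = 3 + B1"
proof -
  define s t b where "s = A0 + C0" and "t = 1 + C1 + A1" and "b = 1 + C0 + C1 + B0 + B1"
  have t1: "t \<ge> 1" and s0: "s \<ge> 0" and b1: "b \<ge> 1" using nn by (auto simp: t_def s_def b_def)
  \<comment> \<open>In these variables the terms \<beta> t cancel from the averaging condition,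
    leaving a lower bound for s \<beta>, the main positive part of Q.\<close>
  have "(b + \<beta>) * t \<le> (s + t) * (\<beta> - (1 + C0 + B0))"
    using cond by (simp add: s_def t_def b_def algebra_simps)
  hence c: "(1 + C0 + B0) * (s + t) + b * t \<le> s * \<beta>"
    by (simp add: algebra_simps)
  have p1: "0 < (1 + C0 + B0) * (s + t)" using nn t1 s0 by (intro mult_pos_pos) auto
  have p2: "0 < b * t" using b1 t1 by simp
  have s1: "s \<ge> 1"
  proof (rule ccontr)
    assume "\<not> s \<ge> 1"
    hence "s = 0" using s0 by simp
    thus False using c p1 p2 by simp
  qed
  have q0: "Q = 2 * (s * \<beta>) + 2 * \<beta> * B0 - (A0 + A1 + B0 + B1 + \<beta>) - 3 * (C0 + C1) + r - 2"
    unfolding Q s_def by (simp add: algebra_simps)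
  have *: "Q \<ge> 0 \<and> (Q = 0 \<longrightarrow> A0 = 1 \<and> A1 = 0 \<and> C0 = 0 \<and> C1 = 0 \<and> B0 = 0 \<and> r = 0 \<and> \<beta> = 3 + B1)"
  proof (cases "s = 1")
    case True
    have "\<beta> \<ge> 1 + C0 + B0 + t * (1 + C0 + B0 + b)"
      using c True by (simp add: algebra_simps)
    moreover have "t * (1 + C0 + B0 + b) = (1 + C1 + A1) * (2 + 2 * C0 + 2 * B0 + C1 + B1)"
      by (simp add: t_def b_def)
    \<comment> \<open>With s = 1 this bounds \<beta> itself from below. The bound offsets all
      negative terms of Q, and Q = 0 forces every surplus term to vanish.\<close>
    ultimately have bb: "\<beta> \<ge> 3 + 3 * C0 + 3 * B0 + 3 * C1 + 2 * A1 + B1 +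
        (C1 * C1 + A1 * C1 + 2 * (C1 * C0) + 2 * (C1 * B0) + C1 * B1 + 2 * (A1 * C0) + 2 * (A1 * B0) + A1 * B1)"
      by (simp add: algebra_simps)
    have pn: "0 \<le> C1 * C1" "0 \<le> A1 * C1" "0 \<le> C1 * C0" "0 \<le> C1 * B0" "0 \<le> C1 * B1" "0 \<le> A1 * C0" "0 \<le> A1 * B0" "0 \<le> A1 * B1" "0 \<le> \<beta> * B0"
      using nn by auto
    have a0: "A0 = 1 - C0" using True s_def by simp
    have q1: "Q = \<beta> + 2 * (\<beta> * B0) - (1 + A1 + B0 + B1) - 2 * C0 - 3 * C1 + r - 2"
      unfolding q0 using True a0 by simp
    show ?thesis
    proof (intro conjI impI)
      show "Q \<ge> 0" unfolding q1 using bb pn nn by linarith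
    next
      assume z: "Q = 0"
      have v: "C0 = 0" "B0 = 0" "A1 = 0" "r = 0" "C1 * C1 = 0" using z bb pn nn unfolding q1 by linarith+
      then show "A0 = 1" "A1 = 0" "C0 = 0" "C1 = 0" "B0 = 0" "r = 0" using a0 by auto
      show "\<beta> = 3 + B1" using z bb v unfolding q1 by auto
    qed
  next
    case False
    hence s2: "s \<ge> 2" using s1 by simp
    \<comment> \<open>Used as \<beta> \<le> s \<beta> / 2, so that 2 s \<beta> - \<beta> is at least
      3/2 s \<beta>; the half explains why 2 Q is estimated below.\<close>
    have b0: "0 \<le> (s - 2) * \<beta>" using s2 nn by simp
    have "(1 + C0 + B0) * (s + t) + b * t = s + 2 * t + (C0 * s + B0 * s) + (2 * (C0 * t) + 2 * (B0 * t) + C1 * t + B1 * t)"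
      by (simp add: b_def algebra_simps)
    moreover have "C0 * s \<ge> C0 * 2" "B0 * s \<ge> 0" "C0 * t \<ge> C0 * 1" "B0 * t \<ge> 0" "C1 * t \<ge> C1 * 1" "B1 * t \<ge> B1 * 1"
      using nn s2 t1 by (auto intro!: mult_left_mono simp del: mult_1_right)
    ultimately have sb: "s * \<beta> \<ge> s + 2 * t + 4 * C0 + C1 + B1" using c by linarith
    have "0 \<le> \<beta> * B0" using nn by simp
    moreover have "2 * (\<beta> * B0) \<ge> B0"
    proof (cases "\<beta> = 0")
      case True thus ?thesis using sb nn s2 t1 by auto
    next
      case False
      hence "\<beta> * B0 \<ge> 1 * B0" using nn by (intro mult_right_mono) auto
      thus ?thesis using nn by simp
    qed
    ultimately have "2 * Q \<ge> 1" using b0 sb nn s2 unfolding q0 t_def s_def by (simp add: algebra_simps)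
    thus ?thesis by auto
  qed
  from * show "Q \<ge> 0" and "Q = 0 \<Longrightarrow> A0 = 1 \<and> A1 = 0 \<and> C0 = 0 \<and> C1 = 0 \<and> B0 = 0 \<and> r = 0 \<and> \<beta> = 3 + B1" by auto
qed

text \<open>Written through n, Q is n - 6 - 2 C1 plus terms that are nonnegative for \<beta> \<ge>
  2, so only a large C1 is dangerous. But then the averaging condition forces (2 + k) \<beta>, where
  k = A0 + C0, to grow quadratically in C1.\<close>

lemma excess_alpha_one:
  fixes A0 A1 C0 C1 B0 B1 \<beta> r :: int
  assumes nn: "A0 \<ge> 0" "A1 \<ge> 0" "C0 \<ge> 0" "C1 \<ge> 0" "B0 \<ge> 0" "B1 \<ge> 0" "\<beta> \<ge> 1" "r \<ge> 0"
    and cond: "(1 + C0 + C1 + B0 + B1 + \<beta>) * (C1 + A1) \<le> (2 + C0 + C1 + A0 + A1) * (\<beta> - 1 - C0 - B0)"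
    and n: "n = 3 + C0 + C1 + A0 + A1 + B0 + B1 + \<beta> + r" "n \<ge> 8"
    and Q: "Q = 2 * (B1 + \<beta> + C1 + A1) + 2 * \<beta> * (A0 + C0 + B0) - (1 + A0 + A1 + B0 + B1 + \<beta>) - 3 * (C0 + C1) + r - 2"
  shows "Q \<ge> 0" and "n \<ge> 12 \<Longrightarrow> Q > 0"
proof -
  have Qn: "Q = n - 6 - 2 * C1 + 2 * ((\<beta> - 1) * (A0 + B0)) + 2 * ((\<beta> - 2) * C0)"
    unfolding Q n by (simp add: algebra_simps)
  have "Q \<ge> 0 \<and> (n \<ge> 12 \<longrightarrow> Q > 0)"
  proof (cases "\<beta> = 1")
    case True
    define a where "a = 2 + C0 + C1 + A0 + A1"
    have a: "a > 0" using nn a_def by auto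
    have "(1 + C0 + C1 + B0 + B1 + \<beta>) * (C1 + A1) + a * (C0 + B0) \<le> 0"
    proof -
      have "(1 + C0 + C1 + B0 + B1 + \<beta>) * (C1 + A1) \<le> a * (\<beta> - 1 - C0 - B0)"
        using cond unfolding a_def .
      moreover have "a * (\<beta> - 1 - C0 - B0) = - (a * (C0 + B0))" using True by (simp add: algebra_simps)
      ultimately show ?thesis by linarith
    qed
    moreover have "(1 + C0 + C1 + B0 + B1 + \<beta>) * (C1 + A1) \<ge> 1 * (C1 + A1)"
      using nn by (intro mult_right_mono) auto
    moreover have "a * (C0 + B0) \<ge> 1 * (C0 + B0)" using nn a by (intro mult_right_mono) auto
    ultimately have "1 * (C1 + A1) + 1 * (C0 + B0) \<le> 0"
      by (meson add_mono order_trans)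
    hence "C1 = 0" "C0 = 0" using nn by auto
    moreover have "(\<beta> - 1) * (A0 + B0) = 0" using True by simp
    ultimately show ?thesis using Qn n by auto
  next
    case False
    hence b2: "\<beta> \<ge> 2" using nn by simp
    have pn: "(\<beta> - 1) * (A0 + B0) \<ge> 0" "(\<beta> - 2) * C0 \<ge> 0" using b2 nn by auto
    show ?thesis
    \<comment> \<open>For C1 \<le> 1 the formula gives Q \<ge> n - 8, so this is where 8
      enters.\<close>
    proof (cases "C1 \<le> 1")
      case True
      thus ?thesis using Qn pn n(2) by auto
    next
      case False
      hence c2: "C1 \<ge> 2" by simp
      define k q where "k = A0 + C0" and "q = C1 + A1"
      have "(1 + C0 + C1 + B0 + B1 + \<beta>) * q \<le> (2 + k + q) * (\<beta> - 1 - C0 - B0)"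
        using cond by (simp add: k_def q_def algebra_simps)
      hence "q * (2 + 2 * C0 + 2 * B0 + C1 + B1) + (2 + k) * (1 + C0 + B0) \<le> (2 + k) * \<beta>"
        by (simp add: algebra_simps)
      moreover have "(2 + k) * (1 + C0 + B0) \<ge> (2 + k) * 1"
        using nn by (intro mult_left_mono) (auto simp: k_def)
      moreover have "q * (2 + 2 * C0 + 2 * B0 + C1 + B1) \<ge> C1 * (2 + C1)"
        using nn by (intro mult_mono) (auto simp: q_def)
      ultimately have kb: "2 + k + 2 * C1 + C1 * C1 \<le> (2 + k) * \<beta>" by (simp add: algebra_simps)
      have cc: "C1 * C1 \<ge> 2 * C1" using c2 nn by (intro mult_right_mono) auto
      have Qk: "Q \<ge> \<beta> - C1 - 3 + (2 * \<beta> - 3) * k"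
      proof -
        have "(2 * \<beta> - 3) * k = 2 * ((\<beta> - 1) * A0) - A0 + 2 * ((\<beta> - 2) * C0) + C0"
          by (simp add: k_def algebra_simps)
        moreover have "(\<beta> - 1) * (A0 + B0) \<ge> (\<beta> - 1) * A0" using b2 nn by (intro mult_left_mono) auto
        ultimately show ?thesis unfolding Qn n using nn by linarith
      qed
      consider "k = 0" | "k = 1" | "k \<ge> 2" using nn by (force simp: k_def)
      thus ?thesis
      proof cases
        case 1
        hence "2 * \<beta> \<ge> 2 + 2 * C1 + C1 * C1" using kb by simp
        hence Qc: "2 * Q \<ge> 2 * C1 + C1 * C1 - 2 * C1 - 4" using Qn pn n nn by linarith
        show ?thesis
        \<comment> \<open>For C1 = 2, \<open>Qc\<close> yields only Q \<ge> 0, and strictness comes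
          from Q \<ge> n - 10. With \<beta> = 5 and the remaining counts 0 one gets n = 10 and Q =
          0.\<close>
        proof (cases "C1 = 2")
          case True
          thus ?thesis using Qc Qn pn by auto
        next
          case False
          hence "3 * 3 \<le> C1 * C1" using c2 by (intro mult_mono) auto
          hence "Q > 0" using Qc by linarith
          thus ?thesis by auto
        qed
      next
        case 2
        have "Q \<ge> C1 * C1 + C1 - 3" using Qk kb unfolding 2 by simp
        hence "Q > 0" using cc c2 by linarith
        thus ?thesis by auto
      next
        case 3
        \<comment> \<open>Equivalent to \<beta> + (2 \<beta> - 3) k \<ge> (2 + k) \<beta> - k - 2,
          which links \<open>Qk\<close> to the quantity bounded in \<open>kb\<close>.\<close>
        have "(k - 1) * (\<beta> - 2) \<ge> 0" using 3 b2 by simp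
        hence "Q \<ge> C1 * C1 + C1 - 3" using Qk kb by (simp add: algebra_simps)
        hence "Q > 0" using cc c2 by linarith
        thus ?thesis by auto
      qed
    qed
  qed
  thus "Q \<ge> 0" and "n \<ge> 12 \<Longrightarrow> Q > 0" by auto
qed

text \<open>The products dominate: 2 \<alpha> \<beta> - \<alpha> - \<beta> is p3 + p4 \<ge> \<alpha>
  + \<beta> \<ge> 4, and each other count has a coefficient of at least 4 in the products but at
  most 3 in the subtracted part.\<close>

lemma excess_alpha_ge_2:
  fixes A0 A1 C0 C1 B0 B1 \<alpha> \<beta> r :: int
  assumes nn: "A0 \<ge> 0" "A1 \<ge> 0" "C0 \<ge> 0" "C1 \<ge> 0" "B0 \<ge> 0" "B1 \<ge> 0" "\<alpha> \<ge> 2" "\<beta> \<ge> 2" "r \<ge> 0"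
    and Q: "Q = 2 * \<alpha> * (B1 + \<beta> + C1 + A1) + 2 * \<beta> * (A0 + C0 + B0) - (\<alpha> + A0 + A1 + B0 + B1 + \<beta>) - 3 * (C0 + C1) + r - 2"
  shows "Q > 0"
proof -
  define p1 p2 p3 p4 where "p1 = \<alpha> * (B1 + C1 + A1)" and "p2 = \<beta> * (A0 + C0 + B0)"
    and "p3 = (\<alpha> - 1) * \<beta>" and "p4 = \<alpha> * (\<beta> - 1)"
  have "2 * (B1 + C1 + A1) \<le> p1"
    unfolding p1_def using nn by (intro mult_right_mono) auto
  moreover have "2 * (A0 + C0 + B0) \<le> p2"
    unfolding p2_def using nn by (intro mult_right_mono) auto
  moreover have "1 * \<beta> \<le> p3"
    unfolding p3_def using nn by (intro mult_right_mono) auto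
  moreover have "\<alpha> * 1 \<le> p4"
    unfolding p4_def using nn by (intro mult_left_mono) auto
  moreover have "Q = 2 * p1 + 2 * p2 + p3 + p4 - (A0 + A1 + B0 + B1) - 3 * (C0 + C1) + r - 2"
    unfolding Q p1_def p2_def p3_def p4_def by (simp add: algebra_simps)
  ultimately show ?thesis using nn by simp
qed

section \<open>Non-edges and the structure in the case of equality\<close>

definition non_edges :: "'a pair_pre_digraph \<Rightarrow> 'a set set" where
  "non_edges G = {{u, v} | u v. u \<in> pverts G \<and> v \<in> pverts G \<and> u \<noteq> v \<and> (u, v) \<notin> parcs G}"

text \<open>In the extremal graph the types 0 and 1 are the endpoints \<open>x\<close> and \<open>y\<close> of the nonpositively
  curved edge, type 2 is the only other neighbour of \<open>x\<close>, and the types 3 and 4 are the other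
  vertices, split by whether they are adjacent to type 2.\<close>

definition extremal_adj :: "nat \<Rightarrow> nat \<Rightarrow> bool" where
  "extremal_adj i j \<longleftrightarrow> {i, j} \<notin> {{0, 3}, {0, 4}, {1, 2}, {2, 4}}"

text \<open>The last two sizes are the solution of \<beta> = 3 + B1 and 3 + B1 + \<beta> = n, the
  equality case of the count.\<close>

definition extremal_class_size :: "nat \<Rightarrow> nat \<Rightarrow> nat" where
  "extremal_class_size n i = (if i < 3 then 1 else if i = 3 then n div 2 - 3 else n div 2)"

text \<open>Such a typing determines the graph up to isomorphism. No pair \<open>{i, i}\<close> is
  excluded by \<open>extremal_adj\<close>, so each class is a clique.\<close>

definition extremal_typing :: "'a pair_pre_digraph \<Rightarrow> ('a \<Rightarrow> nat) \<Rightarrow> bool" where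
  "extremal_typing G t \<longleftrightarrow> (\<forall>v\<in>pverts G. t v < 5) \<and>
     (\<forall>i<5. card {v \<in> pverts G. t v = i} = extremal_class_size (card (pverts G)) i) \<and>
     (\<forall>u\<in>pverts G. \<forall>v\<in>pverts G. u \<noteq> v \<longrightarrow> ((u, v) \<in> parcs G \<longleftrightarrow> extremal_adj (t u) (t v)))"

context pair_graph begin

lemma num_edges_non_edges: "num_edges G + card (non_edges G) = card (pverts G) choose 2"
proof -
  let ?E = "(\<lambda>(u, v). {u, v}) ` parcs G"
  have "{e. e \<subseteq> pverts G \<and> card e = 2} = ?E \<union> non_edges G"
  proof (intro set_eqI iffI)
    fix e assume "e \<in> {e. e \<subseteq> pverts G \<and> card e = 2}"
    then obtain u v where "e = {u, v}" "u \<noteq> v" "u \<in> pverts G" "v \<in> pverts G"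
      by (auto simp: card_2_iff)
    thus "e \<in> ?E \<union> non_edges G" by (cases "(u, v) \<in> parcs G") (auto simp: non_edges_def)
  next
    fix e assume "e \<in> ?E \<union> non_edges G"
    then obtain u v where "e = {u, v}" "u \<noteq> v" "u \<in> pverts G" "v \<in> pverts G"
      using no_loops' in_arcsD1 in_arcsD2 by (fastforce simp: non_edges_def)
    thus "e \<in> {e. e \<subseteq> pverts G \<and> card e = 2}" by simp
  qed
  moreover have "?E \<inter> non_edges G = {}"
    using arcs_symmetric by (auto simp: non_edges_def doubleton_eq_iff)
  moreover have "finite ?E" "finite (non_edges G)"
    using pair_finite_arcs pair_finite_verts calculation(1) by (auto intro: finite_subset[of _ "Pow (pverts G)"] simp: non_edges_def)
  ultimately show ?thesis
    using n_subsets[OF pair_finite_verts, of 2] by (simp add: num_edges_def card_Un_disjoint)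
qed

text \<open>\<open>P\<close> never contains a pair in both orientations, so forgetting the
  orientation is injective. Equality of the cardinalities then leaves no further non-edge, which is
  the source of rigidity.\<close>

lemma non_edges_ge:
  assumes P: "\<And>u v. (u, v) \<in> P \<Longrightarrow> u \<in> pverts G \<and> v \<in> pverts G \<and> u \<noteq> v \<and> (u, v) \<notin> parcs G \<and> (v, u) \<notin> P"
  shows "card P \<le> card (non_edges G)"
    and "card P = card (non_edges G) \<Longrightarrow> u \<in> pverts G \<Longrightarrow> v \<in> pverts G \<Longrightarrow> u \<noteq> v \<Longrightarrow>
      (u, v) \<notin> parcs G \<longleftrightarrow> (u, v) \<in> P \<or> (v, u) \<in> P"
proof -
  let ?h = "\<lambda>(u, v). {u, v}"
  have fin: "finite (non_edges G)"
    using pair_finite_verts by (auto intro: finite_subset[of _ "Pow (pverts G)"] simp: non_edges_def)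
  have inj: "inj_on ?h P" using P by (force simp: inj_on_def doubleton_eq_iff)
  have sub: "?h ` P \<subseteq> non_edges G" using P by (force simp: non_edges_def)
  have c: "card (?h ` P) = card P" using inj by (rule card_image)
  show "card P \<le> card (non_edges G)" using card_mono[OF fin sub] c by simp
  assume "card P = card (non_edges G)" and uv: "u \<in> pverts G" "v \<in> pverts G" "u \<noteq> v"
  hence img: "?h ` P = non_edges G" using card_subset_eq[OF fin sub] c by simp
  show "(u, v) \<notin> parcs G \<longleftrightarrow> (u, v) \<in> P \<or> (v, u) \<in> P"
  proof
    assume "(u, v) \<notin> parcs G"
    hence "{u, v} \<in> ?h ` P" unfolding img non_edges_def using uv by blast
    thus "(u, v) \<in> P \<or> (v, u) \<in> P" by (auto simp: doubleton_eq_iff)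
  next
    assume "(u, v) \<in> P \<or> (v, u) \<in> P"
    thus "(u, v) \<notin> parcs G" using P arcs_symmetric by blast
  qed
qed

end

lemma card_slices:
  fixes f :: "'a \<Rightarrow> int"
  assumes "finite T" "\<And>z. z \<in> T \<Longrightarrow> f z \<in> {-1, 0, 1, 2}"
  shows "card T = card {z \<in> T. f z = -1} + card {z \<in> T. f z = 0} + card {z \<in> T. f z = 1} + card {z \<in> T. f z = 2}"
    and "sum f T = - int (card {z \<in> T. f z = -1}) + int (card {z \<in> T. f z = 1}) + 2 * int (card {z \<in> T. f z = 2})"
proof -
  have *: "sum h T = (\<Sum>i\<in>{-1, 0, 1, 2}. \<Sum>z\<in>{z \<in> T. f z = i}. h z)" for h :: "'a \<Rightarrow> int"
    by (rule sum.group[symmetric]) (use assms in auto)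
  show "card T = card {z \<in> T. f z = -1} + card {z \<in> T. f z = 0} + card {z \<in> T. f z = 1} + card {z \<in> T. f z = 2}"
    using *[of "\<lambda>_. 1"] by simp
  have "(\<Sum>z\<in>{z \<in> T. f z = i}. f z) = i * int (card {z \<in> T. f z = i})" for i by simp
  thus "sum f T = - int (card {z \<in> T. f z = -1}) + int (card {z \<in> T. f z = 1}) + 2 * int (card {z \<in> T. f z = 2})"
    unfolding *[of f] by simp
qed

context pair_graph begin

text \<open>The non-edges counted here, as ordered pairs \<open>P\<close>, are those at \<open>x\<close>, those at \<open>y\<close>, and those
  between vertices on which \<open>f\<close> differs by at least 2.\<close>

lemma non_edges_bound_ordered:
  fixes f :: "'a \<Rightarrow> int"
  assumes xy: "(x, y) \<in> parcs G" and fx: "f x = 0" and fy: "f y = 1"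
    and lip: "\<And>u v. \<lbrakk>u \<in> nbs G x \<union> nbs G y; v \<in> nbs G x \<union> nbs G y; (u, v) \<in> parcs G\<rbrakk> \<Longrightarrow> f v - f u \<le> 1"
    and avg: "int (card (nbs G x)) * int (card (nbs G y)) + int (card (nbs G y)) * (\<Sum>z\<in>nbs G x. f z)
      \<le> int (card (nbs G x)) * (\<Sum>z\<in>nbs G y. f z)"
    and ord: "card {z \<in> nbs G x - nbs G y - {y}. f z = -1} \<le> card {z \<in> nbs G y - nbs G x - {x}. f z = 2}"
    and n: "card (pverts G) \<ge> 8"
  shows "3 * card (pverts G) \<le> 2 * card (non_edges G) + 4"
    and "\<lbrakk>card (pverts G) \<ge> 12; 2 * card (non_edges G) + 4 = 3 * card (pverts G)\<rbrakk> \<Longrightarrow> \<exists>t. extremal_typing G t"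
proof -
  have yx: "(y, x) \<in> parcs G" using xy arcs_symmetric by blast
  let ?V = "pverts G"
  define X Y where "X = nbs G x" and "Y = nbs G y"
  define A B C where "A = X - Y - {y}" and "B = Y - X - {x}" and "C = X \<inter> Y"
  have V: "x \<in> ?V" "y \<in> ?V" "x \<noteq> y" using xy in_arcsD1 in_arcsD2 no_loops' by auto
  have mem: "y \<in> X" "x \<in> Y" "x \<notin> X" "y \<notin> Y" using xy yx not_mem_nbs_self by (auto simp: X_def Y_def nbs_iff)
  have XV: "X \<subseteq> ?V" "Y \<subseteq> ?V" using nbs_sub by (auto simp: X_def Y_def)
  have fin: "finite X" "finite Y" "finite A" "finite B" "finite C" "finite ?V"
    using finite_nbs pair_finite_verts by (auto simp: X_def Y_def A_def B_def C_def)
  have lip': "\<bar>f v - f u\<bar> \<le> 1" if "u \<in> X \<union> Y" "v \<in> X \<union> Y" "(u, v) \<in> parcs G" for u v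
    using lip[of u v] lip[of v u] that arcs_symmetric[of u v] by (auto simp: X_def Y_def)
  have fX: "\<bar>f z\<bar> \<le> 1" if "z \<in> X" for z
    using lip'[of x z] that mem fx by (auto simp: X_def nbs_iff)
  have fY: "\<bar>f z - 1\<bar> \<le> 1" if "z \<in> Y" for z
    using lip'[of y z] that mem fy by (auto simp: Y_def nbs_iff)
  define cA cB cC where "cA i = card {z \<in> A. f z = i}" and "cB i = card {z \<in> B. f z = i}"
    and "cC i = card {z \<in> C. f z = i}" for i
  have rA: "f z \<in> {-1, 0, 1}" if "z \<in> A" for z using fX[of z] that by (auto simp: A_def)
  have rB: "f z \<in> {0, 1, 2}" if "z \<in> B" for z using fY[of z] that by (auto simp: B_def)
  have rC: "f z \<in> {0, 1}" if "z \<in> C" for z using fX[of z] fY[of z] that by (auto simp: C_def)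
  have e: "{z \<in> A. f z = 2} = {}" "{z \<in> B. f z = -1} = {}" "{z \<in> C. f z = -1} = {}" "{z \<in> C. f z = 2} = {}"
    using rA rB rC by fastforce+
  have sA: "card A = cA (-1) + cA 0 + cA 1" "sum f A = int (cA 1) - int (cA (-1))"
    using card_slices[OF fin(3), of f] rA e by (auto simp: cA_def)
  have sB: "card B = cB 0 + cB 1 + cB 2" "sum f B = int (cB 1) + 2 * int (cB 2)"
    using card_slices[OF fin(4), of f] rB e by (auto simp: cB_def)
  have sC: "card C = cC 0 + cC 1" "sum f C = int (cC 1)"
    using card_slices[OF fin(5), of f] rC e by (auto simp: cC_def)
  have X: "X = insert y (A \<union> C)" "y \<notin> A \<union> C" "A \<inter> C = {}" using mem by (auto simp: A_def C_def)
  have Y: "Y = insert x (B \<union> C)" "x \<notin> B \<union> C" "B \<inter> C = {}" using mem by (auto simp: B_def C_def)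
  have cX: "card X = 1 + card A + card C" "sum f X = 1 + sum f A + sum f C"
    using X fin fy by (simp_all add: card_Un_disjoint sum.union_disjoint)
  have cY: "card Y = 1 + card B + card C" "sum f Y = sum f B + sum f C"
    using Y fin fx by (simp_all add: card_Un_disjoint sum.union_disjoint)
  have "X \<union> Y = Y \<union> insert y A" "Y \<inter> insert y A = {}" using X Y mem by (auto simp: A_def)
  hence "card (X \<union> Y) = card Y + card (insert y A)"
    using card_Un_disjoint[of Y "insert y A"] fin by simp
  hence cXY: "card (X \<union> Y) = 2 + card A + card B + card C" using cY fin X(2) by simp
  obtain r where r: "card ?V = 2 + card A + card B + card C + r"
    using card_mono[of ?V "X \<union> Y"] XV fin cXY by (metis Un_least nat_le_iff_add)

  \<comment> \<open>Arranged so that nothing is counted twice: non-edges at x and y are already in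
    the first two blocks, hence y and x are removed here, and pairs between \<open>Am\<close> and
    \<open>Bp\<close> occur only through \<open>T3\<close>, since \<open>T4\<close> requires the
    value 0.\<close>
  define T3 T4 where "T3 = {z \<in> X \<union> Y - {y}. f z \<in> {1, 2}}" and "T4 = {z \<in> X \<union> Y - {x}. f z = 0}"
  define Am Bp where "Am = {z \<in> A. f z = -1}" and "Bp = {z \<in> B. f z = 2}"
  define P where "P = {x} \<times> (?V - X - {x}) \<union> {y} \<times> (?V - Y - {y}) \<union> Am \<times> T3 \<union> Bp \<times> T4"
  have U: "X \<union> Y = insert x (insert y (A \<union> B \<union> C))" using X(1) Y(1) by blast
  have xyABC: "x \<notin> A \<union> B \<union> C" "y \<notin> A \<union> B \<union> C" using X(2) Y(2) mem by (auto simp: A_def B_def)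
  have T3: "T3 = {z \<in> B. f z = 1} \<union> {z \<in> B. f z = 2} \<union> {z \<in> C. f z = 1} \<union> {z \<in> A. f z = 1}"
  proof (rule set_eqI)
    fix z
    show "z \<in> T3 \<longleftrightarrow> z \<in> {z \<in> B. f z = 1} \<union> {z \<in> B. f z = 2} \<union> {z \<in> C. f z = 1} \<union> {z \<in> A. f z = 1}"
      unfolding T3_def U using xyABC fx fy rA[of z] rC[of z] by auto
  qed
  have T4: "T4 = {z \<in> A. f z = 0} \<union> {z \<in> C. f z = 0} \<union> {z \<in> B. f z = 0}"
  proof (rule set_eqI)
    fix z
    show "z \<in> T4 \<longleftrightarrow> z \<in> {z \<in> A. f z = 0} \<union> {z \<in> C. f z = 0} \<union> {z \<in> B. f z = 0}"
      unfolding T4_def U using xyABC fx fy by auto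
  qed
  have ABC: "A \<inter> B = {}" "A \<inter> C = {}" "B \<inter> C = {}" by (auto simp: A_def B_def C_def)
  have cT3: "card T3 = cB 1 + cB 2 + cC 1 + cA 1"
  proof -
    have "{z \<in> B. f z = 1} \<inter> {z \<in> B. f z = 2} = {}"
      "({z \<in> B. f z = 1} \<union> {z \<in> B. f z = 2}) \<inter> {z \<in> C. f z = 1} = {}"
      "({z \<in> B. f z = 1} \<union> {z \<in> B. f z = 2} \<union> {z \<in> C. f z = 1}) \<inter> {z \<in> A. f z = 1} = {}"
      using ABC by auto
    thus ?thesis unfolding T3 cA_def cB_def cC_def using fin(3-5)
      by (simp only: card_Un_disjoint finite_Un finite_Collect_conjI Collect_mem_eq simp_thms)
  qed
  have cT4: "card T4 = cA 0 + cC 0 + cB 0"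
  proof -
    have "{z \<in> A. f z = 0} \<inter> {z \<in> C. f z = 0} = {}"
      "({z \<in> A. f z = 0} \<union> {z \<in> C. f z = 0}) \<inter> {z \<in> B. f z = 0} = {}"
      using ABC by auto
    thus ?thesis unfolding T4 cA_def cB_def cC_def using fin(3-5)
      by (simp only: card_Un_disjoint finite_Un finite_Collect_conjI Collect_mem_eq simp_thms)
  qed
  have cV: "card (?V - X - {x}) = card B + r" "card (?V - Y - {y}) = card A + r"
  proof -
    have "card (?V - X - {x}) = card ?V - card X - 1"
      using fin XV V mem by (simp add: card_Diff_subset)
    thus "card (?V - X - {x}) = card B + r" using r cX by simp
    have "card (?V - Y - {y}) = card ?V - card Y - 1"
      using fin XV V mem by (simp add: card_Diff_subset)
    thus "card (?V - Y - {y}) = card A + r" using r cY by simp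
  qed
  have AmBp: "x \<notin> Am" "y \<notin> Am" "x \<notin> Bp" "y \<notin> Bp" "Am \<inter> Bp = {}"
    using fx fy by (auto simp: Am_def Bp_def)
  have finT: "finite T3" "finite T4" "finite Am" "finite Bp" using fin by (auto simp: T3_def T4_def Am_def Bp_def)
  have "({x} \<times> (?V - X - {x})) \<inter> ({y} \<times> (?V - Y - {y})) = {}"
    "({x} \<times> (?V - X - {x}) \<union> {y} \<times> (?V - Y - {y})) \<inter> (Am \<times> T3) = {}"
    "({x} \<times> (?V - X - {x}) \<union> {y} \<times> (?V - Y - {y}) \<union> Am \<times> T3) \<inter> (Bp \<times> T4) = {}"
    using AmBp V(3) by auto
  hence "card P = card ({x} \<times> (?V - X - {x})) + card ({y} \<times> (?V - Y - {y})) + card (Am \<times> T3) + card (Bp \<times> T4)"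
    unfolding P_def using fin(6) finT by (simp only: card_Un_disjoint finite_SigmaI finite_Un finite_Diff finite.emptyI finite_insert)
  hence cP: "card P = (card B + r) + (card A + r) + cA (-1) * card T3 + cB 2 * card T4"
    using cV by (simp add: card_cartesian_product cA_def cB_def Am_def Bp_def)
  have P: "u \<in> ?V \<and> v \<in> ?V \<and> u \<noteq> v \<and> (u, v) \<notin> parcs G \<and> (v, u) \<notin> P" if uv: "(u, v) \<in> P" for u v
  proof -
    consider "u = x" "v \<in> ?V - X - {x}" | "u = y" "v \<in> ?V - Y - {y}" | "u \<in> Am" "v \<in> T3" | "u \<in> Bp" "v \<in> T4"
      using uv by (auto simp: P_def)
    thus ?thesis
    proof cases
      case 1
      thus ?thesis using V mem AmBp by (auto simp: P_def X_def nbs_iff T3_def T4_def Am_def Bp_def A_def B_def fx)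
    next
      case 2
      thus ?thesis using V mem AmBp by (auto simp: P_def Y_def nbs_iff T3_def T4_def Am_def Bp_def A_def B_def fy)
    next
      case 3
      hence "f v - f u \<ge> 2" "u \<in> X \<union> Y" "v \<in> X \<union> Y" by (auto simp: Am_def T3_def A_def)
      hence "(u, v) \<notin> parcs G" using lip'[of u v] by auto
      moreover have "u \<in> ?V" "v \<in> ?V" using XV \<open>u \<in> X \<union> Y\<close> \<open>v \<in> X \<union> Y\<close> by auto
      ultimately show ?thesis using 3 fx fy by (auto simp: P_def T3_def T4_def Am_def Bp_def)
    next
      case 4
      hence "f u - f v \<ge> 2" "u \<in> X \<union> Y" "v \<in> X \<union> Y" by (auto simp: Bp_def T4_def B_def)
      hence "(u, v) \<notin> parcs G" using lip'[of u v] by auto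
      moreover have "u \<in> ?V" "v \<in> ?V" using XV \<open>u \<in> X \<union> Y\<close> \<open>v \<in> X \<union> Y\<close> by auto
      ultimately show ?thesis using 4 fx fy by (auto simp: P_def T3_def T4_def Am_def Bp_def)
    qed
  qed
  note ge = non_edges_ge(1)[of P, OF P] and eq = non_edges_ge(2)[of P, OF P]

  define \<alpha> A0 A1 C0 C1 B0 B1 \<beta> R where "\<alpha> = int (cA (-1))" and "A0 = int (cA 0)" and "A1 = int (cA 1)"
    and "C0 = int (cC 0)" and "C1 = int (cC 1)" and "B0 = int (cB 0)" and "B1 = int (cB 1)" and "\<beta> = int (cB 2)"
    and "R = int r"
  note defs = \<alpha>_def A0_def A1_def C0_def C1_def B0_def B1_def \<beta>_def R_def
  have nn: "\<alpha> \<ge> 0" "A0 \<ge> 0" "A1 \<ge> 0" "C0 \<ge> 0" "C1 \<ge> 0" "B0 \<ge> 0" "B1 \<ge> 0" "\<beta> \<ge> 0" "R \<ge> 0" by (simp_all add: defs)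
  have N: "int (card ?V) = 2 + \<alpha> + A0 + A1 + B0 + B1 + \<beta> + C0 + C1 + R"
    using r sA sB sC by (simp add: defs)
  have ca: "int (card X) = 1 + C0 + C1 + \<alpha> + A0 + A1" "int (card Y) = 1 + C0 + C1 + B0 + B1 + \<beta>"
    using cX cY sA sB sC by (simp_all add: defs)
  have sfX: "sum f X = 1 + C1 + A1 - \<alpha>" and sfY: "sum f Y = C1 + B1 + 2 * \<beta>"
    using cX cY sA sB sC by (simp_all add: defs)
  have "int (card X) * int (card Y) + int (card Y) * sum f X \<le> int (card X) * sum f Y"
    using avg by (simp add: X_def Y_def)
  hence cond: "(1 + C0 + C1 + B0 + B1 + \<beta>) * (1 + C1 + A1 - \<alpha>) \<le> (1 + C0 + C1 + \<alpha> + A0 + A1) * (\<beta> - 1 - C0 - B0)"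
    unfolding ca sfX sfY by (simp add: algebra_simps)
  have ord': "\<alpha> \<le> \<beta>" using ord by (simp add: defs cA_def cB_def A_def B_def X_def Y_def)
  define Q where "Q = 2 * \<alpha> * (B1 + \<beta> + C1 + A1) + 2 * \<beta> * (A0 + C0 + B0) - (\<alpha> + A0 + A1 + B0 + B1 + \<beta>) - 3 * (C0 + C1) + R - 2"
  have "int (card P) = (B0 + B1 + \<beta> + R) + (\<alpha> + A0 + A1 + R) + \<alpha> * (B1 + \<beta> + C1 + A1) + \<beta> * (A0 + C0 + B0)"
    unfolding cP cT3 cT4 using sA sB by (simp add: defs)
  hence QP: "2 * int (card P) = 3 * int (card ?V) - 4 + Q"
    unfolding N Q_def by (simp add: algebra_simps)
  have n': "int (card ?V) \<ge> 8" using n by simp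
  consider "\<alpha> = 0" | "\<alpha> = 1" | "\<alpha> \<ge> 2" using nn(1) by linarith
  hence Q: "Q \<ge> 0 \<and> (int (card ?V) \<ge> 12 \<and> Q = 0 \<longrightarrow>
      \<alpha> = 0 \<and> A0 = 1 \<and> A1 = 0 \<and> C0 = 0 \<and> C1 = 0 \<and> B0 = 0 \<and> R = 0 \<and> \<beta> = 3 + B1)"
  proof cases
    case 1
    have "Q \<ge> 0" "Q = 0 \<Longrightarrow> A0 = 1 \<and> A1 = 0 \<and> C0 = 0 \<and> C1 = 0 \<and> B0 = 0 \<and> R = 0 \<and> \<beta> = 3 + B1"
      by (rule excess_alpha_zero[of A0 A1 C0 C1 B0 B1 \<beta> R Q];
        use nn cond 1 in \<open>simp add: Q_def\<close>)+
    thus ?thesis using 1 by blast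
  next
    case 2
    have "1 + C0 + C1 + \<alpha> + A0 + A1 = 2 + C0 + C1 + A0 + A1" "1 + C1 + A1 - \<alpha> = C1 + A1" using 2 by auto
    note cond2 = cond[unfolded this]
    have "Q \<ge> 0" "int (card ?V) \<ge> 12 \<Longrightarrow> Q > 0"
      by (rule excess_alpha_one[of A0 A1 C0 C1 B0 B1 \<beta> R "int (card ?V)" Q];
        use nn cond2 2 ord' N n' in \<open>simp only: Q_def; simp\<close>)+
    thus ?thesis by auto
  next
    case 3
    have "Q > 0"
      by (rule excess_alpha_ge_2[of A0 A1 C0 C1 B0 B1 \<alpha> \<beta> R Q];
        use nn 3 ord' in \<open>simp add: Q_def\<close>)
    thus ?thesis by auto
  qed
  show "3 * card ?V \<le> 2 * card (non_edges G) + 4" using QP Q ge by linarith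
  assume n12: "card ?V \<ge> 12" and tight: "2 * card (non_edges G) + 4 = 3 * card ?V"
  \<comment> \<open>Equality in the total forces equality in both estimates: the counts are the
    extremal ones, and \<open>P\<close> exhausts the non-edges.\<close>
  have "Q = 0" "card P = card (non_edges G)" using QP Q ge tight by linarith+
  hence vals: "cA (-1) = 0" "cA 0 = 1" "cA 1 = 0" "cC 0 = 0" "cC 1 = 0" "cB 0 = 0" "r = 0" "cB 2 = 3 + cB 1"
    using Q n12 by (auto simp: defs)
  have C0: "C = {}" "Am = {}" using vals sC fin by (auto simp: Am_def cA_def)
  have VXY: "?V = X \<union> Y" using card_subset_eq[of ?V "X \<union> Y"] XV fin r vals cXY by simp
  have cv: "card ?V = 6 + 2 * cB 1" using r vals sA sB sC by simp
  have "card A = 1" using sA vals by simp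
  then obtain a where a: "A = {a}" by (auto simp: card_1_singleton_iff)
  have fa: "f a = 0"
  proof -
    have "{z \<in> A. f z = 0} \<noteq> {}" using vals(2) unfolding cA_def by force
    thus ?thesis using a by auto
  qed
  have B0: "f z \<in> {1, 2}" if "z \<in> B" for z
  proof -
    have "{z \<in> B. f z = 0} = {}" using vals(6) fin by (simp add: cB_def)
    thus ?thesis using rB[OF that] that by auto
  qed
  define t :: "'a \<Rightarrow> nat" where "t v = (if v = x then 0 else if v = y then 1 else if v = a then 2 else if f v = 1 then 3 else 4)" for v
  have Vd: "?V = {x, y, a} \<union> B" unfolding VXY X Y a C0 by auto
  have dis: "a \<noteq> x" "a \<noteq> y" "x \<notin> B" "y \<notin> B" "a \<notin> B"
    using a ABC(1) xyABC by auto
  have tv: "t x = 0" "t y = 1" "t a = 2" using dis V(3) by (auto simp: t_def)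
  have tB: "t z = (if f z = 1 then 3 else 4)" if "z \<in> B" for z
    using that dis by (auto simp: t_def)
  have tB': "z \<in> B \<Longrightarrow> t z = 3 \<longleftrightarrow> f z = 1" "z \<in> B \<Longrightarrow> t z = 4 \<longleftrightarrow> f z = 2"
    "z \<in> B \<Longrightarrow> t z > 2" for z using tB[of z] B0[of z] by auto
  have sl: "{v \<in> ?V. t v = i} = {v \<in> {x, y, a}. t v = i} \<union> {v \<in> B. t v = i}" for i
    unfolding Vd by blast
  have sB': "{v \<in> B. t v = 3} = {z \<in> B. f z = 1}" "{v \<in> B. t v = 4} = {z \<in> B. f z = 2}"
    using tB' by blast+
  have sB0: "{v \<in> B. t v = i} = {}" if "i \<le> 2" for i using tB'(3) that by fastforce
  have s3: "{v \<in> {x, y, a}. t v = i} = (if i = 0 then {x} else if i = 1 then {y} else if i = 2 then {a} else {})" for i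
    using tv by auto
  have "\<forall>i<5. card {v \<in> ?V. t v = i} = extremal_class_size (card ?V) i"
  proof (intro allI impI)
    fix i :: nat assume "i < 5"
    then consider "i = 0" | "i = 1" | "i = 2" | "i = 3" | "i = 4" by linarith
    thus "card {v \<in> ?V. t v = i} = extremal_class_size (card ?V) i"
      by cases (use cv vals in \<open>simp_all add: sl[unfolded s3] sB0 sB' extremal_class_size_def cB_def\<close>)
  qed
  moreover have "(u, v) \<in> parcs G \<longleftrightarrow> extremal_adj (t u) (t v)" if "u \<in> ?V" "v \<in> ?V" "u \<noteq> v" for u v
  proof -
    have nadj: "(u, v) \<notin> parcs G \<longleftrightarrow> (u, v) \<in> P \<or> (v, u) \<in> P"
      using eq \<open>card P = card (non_edges G)\<close> that by blast
    have "?V - X - {x} = B" unfolding VXY B_def by blast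
    moreover have "?V - Y - {y} = {a}" unfolding VXY a[symmetric] A_def by blast
    moreover have "T4 = {a}" unfolding T4 C0 a using fa B0 by fastforce
    ultimately have "P = {x} \<times> B \<union> {y} \<times> {a} \<union> {z \<in> B. f z = 2} \<times> {a}" using C0 by (simp add: P_def Bp_def)
    with nadj have adj: "(u, v) \<in> parcs G \<longleftrightarrow> \<not> ((u = x \<and> v \<in> B) \<or> (u = y \<and> v = a) \<or> (u \<in> B \<and> f u = 2 \<and> v = a)
        \<or> (v = x \<and> u \<in> B) \<or> (v = y \<and> u = a) \<or> (v \<in> B \<and> f v = 2 \<and> u = a))" by auto
    have cl: "w = x \<or> w = y \<or> w = a \<or> (w \<in> B \<and> w \<noteq> x \<and> w \<noteq> y \<and> w \<noteq> a \<and> (f w = 1 \<or> f w = 2))" if "w \<in> ?V" for w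
      using that Vd dis B0 by auto
    show ?thesis unfolding adj
      using cl[OF that(1)] cl[OF that(2)] that(3) dis V(3)
      by (elim disjE conjE; simp add: t_def extremal_adj_def doubleton_eq_iff)
  qed
  moreover have "\<forall>v\<in>?V. t v < 5" by (simp add: t_def)
  ultimately show "\<exists>t. extremal_typing G t" unfolding extremal_typing_def by blast
qed

lemma non_edges_bound:
  assumes xy: "(x, y) \<in> parcs G" and nonpos: "kappa_LLY G x y \<le> 0" and n: "card (pverts G) \<ge> 8"
  shows "3 * card (pverts G) \<le> 2 * card (non_edges G) + 4"
    and "\<lbrakk>card (pverts G) \<ge> 12; 2 * card (non_edges G) + 4 = 3 * card (pverts G)\<rbrakk> \<Longrightarrow> \<exists>t. extremal_typing G t"
proof -
  obtain f where f: "f x = (0::int)" "f y = 1"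
    and lip: "\<And>u v. \<lbrakk>u \<in> nbs G x \<union> nbs G y; v \<in> nbs G x \<union> nbs G y; (u, v) \<in> parcs G\<rbrakk> \<Longrightarrow> f v - f u \<le> 1"
    and avg: "int (card (nbs G x)) * int (card (nbs G y)) + int (card (nbs G y)) * (\<Sum>z\<in>nbs G x. f z)
      \<le> int (card (nbs G x)) * (\<Sum>z\<in>nbs G y. f z)"
    using lipschitz_witness[OF xy nonpos] by blast
  let ?l = "card {z \<in> nbs G x - nbs G y - {y}. f z = -1}"
  let ?r = "card {z \<in> nbs G y - nbs G x - {x}. f z = 2}"
  have "3 * card (pverts G) \<le> 2 * card (non_edges G) + 4 \<and>
    (card (pverts G) \<ge> 12 \<and> 2 * card (non_edges G) + 4 = 3 * card (pverts G) \<longrightarrow> (\<exists>t. extremal_typing G t))"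
  proof (cases "?l \<le> ?r")
    case True
    show ?thesis using non_edges_bound_ordered[OF xy f lip avg True n] by blast
  next
    case False
    have yx: "(y, x) \<in> parcs G" using xy arcs_symmetric by blast
    \<comment> \<open>This reflection exchanges the values -1 and 2 and reverses all differences;
      symmetry of the arcs restores the Lipschitz bound with the roles of x and y swapped.\<close>
    define g where "g z = 1 - f z" for z
    have gl: "g v - g u \<le> 1" if "u \<in> nbs G y \<union> nbs G x" "v \<in> nbs G y \<union> nbs G x" "(u, v) \<in> parcs G" for u v
      using lip[of v u] that arcs_symmetric[of u v] by (auto simp: g_def)
    have gs: "(\<Sum>z\<in>T. g z) = int (card T) - (\<Sum>z\<in>T. f z)" for T
      by (simp add: g_def sum_subtractf)
    have ga: "int (card (nbs G y)) * int (card (nbs G x)) + int (card (nbs G x)) * (\<Sum>z\<in>nbs G y. g z)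
      \<le> int (card (nbs G y)) * (\<Sum>z\<in>nbs G x. g z)"
      using avg unfolding gs by (simp add: algebra_simps)
    have go: "card {z \<in> nbs G y - nbs G x - {x}. g z = -1} \<le> card {z \<in> nbs G x - nbs G y - {y}. g z = 2}"
    proof -
      have "g z = -1 \<longleftrightarrow> f z = 2" "g z = 2 \<longleftrightarrow> f z = -1" for z by (auto simp: g_def)
      thus ?thesis using False by simp
    qed
    have gxy: "g y = 0" "g x = 1" using f by (auto simp: g_def)
    show ?thesis using non_edges_bound_ordered[OF yx gxy gl ga go n] by blast
  qed
  thus "3 * card (pverts G) \<le> 2 * card (non_edges G) + 4"
    and "\<lbrakk>card (pverts G) \<ge> 12; 2 * card (non_edges G) + 4 = 3 * card (pverts G)\<rbrakk> \<Longrightarrow> \<exists>t. extremal_typing G t"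
    by blast+
qed

end

section \<open>The extremal graph\<close>

text \<open>Classes of equal size admit bijections, and these glue to an isomorphism because
  adjacency of distinct vertices depends only on their types.\<close>

lemma extremal_typing_iso:
  assumes "pair_graph G" "pair_graph H" and s: "extremal_typing G s" and t: "extremal_typing H t"
    and n: "card (pverts G) = card (pverts H)"
  shows "digraph_iso (with_proj G) (with_proj H)"
proof -
  interpret G: pair_graph G by fact
  interpret H: pair_graph H by fact
  let ?F = "\<lambda>i. {v \<in> pverts G. s v = i}" and ?K = "\<lambda>i. {v \<in> pverts H. t v = i}"
  have "\<exists>h. bij_betw h (?F i) (?K i)" if "i < 5" for i
    using s t n that G.pair_finite_verts H.pair_finite_verts
    by (intro finite_same_card_bij) (auto simp: extremal_typing_def)
  hence "\<forall>i. \<exists>h. i < 5 \<longrightarrow> bij_betw h (?F i) (?K i)" by blast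
  then obtain h' where "\<forall>i. i < 5 \<longrightarrow> bij_betw (h' i) (?F i) (?K i)" by (rule choice[THEN exE])
  hence h': "\<And>i. i < 5 \<Longrightarrow> bij_betw (h' i) (?F i) (?K i)" by blast
  define h where "h v = h' (s v) v" for v
  have s5: "s v < 5" if "v \<in> pverts G" for v using s that by (auto simp: extremal_typing_def)
  have t5: "t v < 5" if "v \<in> pverts H" for v using t that by (auto simp: extremal_typing_def)
  have hV: "h v \<in> pverts H" "t (h v) = s v" if "v \<in> pverts G" for v
    using bij_betwE[OF h'[OF s5[OF that]]] that by (auto simp: h_def)
  have inj: "inj_on h (pverts G)"
  proof (rule inj_onI)
    fix u v assume uv: "u \<in> pverts G" "v \<in> pverts G" "h u = h v"
    hence suv: "s u = s v" using hV(2) by metis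
    show "u = v"
      using bij_betw_imp_inj_on[OF h'[OF s5[OF uv(1)]]] uv suv by (auto simp: h_def inj_on_def)
  qed
  have surj: "h ` pverts G = pverts H"
  proof (intro equalityI subsetI)
    fix w assume w: "w \<in> pverts H"
    have "w \<in> h' (t w) ` ?F (t w)" using bij_betw_imp_surj_on[OF h'[OF t5[OF w]]] w by auto
    thus "w \<in> h ` pverts G" unfolding h_def by (auto intro!: rev_image_eqI)
  qed (use hV in auto)
  have arc: "(h u, h v) \<in> parcs H \<longleftrightarrow> (u, v) \<in> parcs G" if uv: "u \<in> pverts G" "v \<in> pverts G" for u v
  proof (cases "u = v")
    case True
    thus ?thesis using G.no_loops' H.no_loops' by blast
  next
    case False
    hence "h u \<noteq> h v" using inj uv by (auto simp: inj_on_def)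
    thus ?thesis using False s t hV[OF uv(1)] hV[OF uv(2)] uv by (auto simp: extremal_typing_def)
  qed
  have arcs: "map_prod h h ` parcs G = parcs H"
  proof (intro equalityI subsetI)
    fix e assume "e \<in> map_prod h h ` parcs G"
    thus "e \<in> parcs H" using arc by (auto dest: G.in_arcsD1 G.in_arcsD2)
  next
    fix e assume e: "e \<in> parcs H"
    obtain a b where ab: "e = (a, b)" by (cases e)
    hence "a \<in> h ` pverts G" "b \<in> h ` pverts G" using e H.in_arcsD1 H.in_arcsD2 surj by auto
    then obtain u v where uv: "e = (h u, h v)" "u \<in> pverts G" "v \<in> pverts G" using ab by auto
    hence "(u, v) \<in> parcs G" using arc e by simp
    thus "e \<in> map_prod h h ` parcs G" using uv(1) by force
  qed
  define iso where "iso = \<lparr>iso_verts = h, iso_arcs = map_prod h h, iso_head = snd, iso_tail = fst\<rparr>"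
  have "inj_on (map_prod h h) (parcs G)"
    by (rule inj_on_subset[OF map_prod_inj_on[OF inj inj]]) (auto dest: G.in_arcsD1 G.in_arcsD2)
  hence "pre_digraph.digraph_isomorphism (with_proj G) iso"
    using inj G.wf_digraph_axioms by (auto simp: pre_digraph.digraph_isomorphism_def iso_def)
  moreover have "with_proj H = app_iso iso (with_proj G)"
    using surj arcs by (simp add: app_iso_def iso_def with_proj_def)
  ultimately show ?thesis unfolding digraph_iso_def by blast
qed

section \<open>A concrete extremal graph and its nonpositively curved edge\<close>

definition standard_typing :: "nat \<Rightarrow> nat \<Rightarrow> nat" where
  "standard_typing n v = (if v < 3 then v else if v < n div 2 then 3 else 4)"

definition extremal_graph :: "nat \<Rightarrow> nat pair_pre_digraph" where
  "extremal_graph n = \<lparr>pverts = {..<n},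
     parcs = {(u, v). u < n \<and> v < n \<and> u \<noteq> v \<and> extremal_adj (standard_typing n u) (standard_typing n v)}\<rparr>"

lemma extremal_adj_sym: "extremal_adj i j \<longleftrightarrow> extremal_adj j i"
  by (simp add: extremal_adj_def insert_commute)

lemma pair_graph_extremal_graph: "pair_graph (extremal_graph n)"
proof
  show "finite (pverts (extremal_graph n))" by (simp add: extremal_graph_def)
  have "parcs (extremal_graph n) \<subseteq> {..<n} \<times> {..<n}" by (auto simp: extremal_graph_def)
  thus "finite (parcs (extremal_graph n))" using finite_subset by blast
  show "symmetric (with_proj (extremal_graph n))"
    using extremal_adj_sym by (auto simp: symmetric_def sym_def extremal_graph_def)
qed (auto simp: extremal_graph_def)

lemma extremal_typing_extremal_graph:
  assumes "12 \<le> n" "even n"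
  shows "extremal_typing (extremal_graph n) (standard_typing n)"
proof -
  have m: "6 \<le> n div 2" "n = 2 * (n div 2)" using assms by auto
  have "card {v \<in> {..<n}. standard_typing n v = i} = extremal_class_size n i" if i: "i < 5" for i
  proof -
    consider "i < 3" | "i = 3" | "i = 4" using i by linarith
    thus ?thesis
    proof cases
      case 1
      hence "{v \<in> {..<n}. standard_typing n v = i} = {i}" using m by (auto simp: standard_typing_def split: if_splits)
      thus ?thesis using 1 by (simp add: extremal_class_size_def)
    next
      case 2
      hence "{v \<in> {..<n}. standard_typing n v = i} = {3..<n div 2}" using m by (auto simp: standard_typing_def split: if_splits)
      thus ?thesis using 2 by (simp add: extremal_class_size_def)
    next
      case 3
      hence "{v \<in> {..<n}. standard_typing n v = i} = {n div 2..<n}" using m by (auto simp: standard_typing_def split: if_splits)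
      thus ?thesis using 3 m by (simp add: extremal_class_size_def)
    qed
  qed
  thus ?thesis by (auto simp: extremal_typing_def extremal_graph_def standard_typing_def)
qed

text \<open>The potential is read off the equality case. Its averages over the neighbours of 0 and 1
  are 1/2 and 3/2; as these differ by exactly 1, weak duality gives transport distance at least 1
  for every idleness.\<close>

lemma extremal_graph_kappa:
  assumes n: "12 \<le> n" "even n"
  shows "(0, 1) \<in> parcs (extremal_graph n)" and "kappa_LLY (extremal_graph n) 0 1 \<le> 0"
proof -
  interpret E: pair_graph "extremal_graph n" by (rule pair_graph_extremal_graph)
  obtain k where k: "n = 2 * k" "6 \<le> k" using n by (auto elim!: evenE)
  show a: "(0, 1) \<in> parcs (extremal_graph n)"
    using n by (simp add: extremal_graph_def standard_typing_def extremal_adj_def doubleton_eq_iff)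
  have X: "nbs (extremal_graph n) 0 = {1, 2}"
    using k by (auto simp: nbs_def extremal_graph_def standard_typing_def extremal_adj_def doubleton_eq_iff split: if_splits)
  have Y: "nbs (extremal_graph n) 1 = {0} \<union> {3..<k} \<union> {k..<n}"
    using k by (auto simp: nbs_def extremal_graph_def standard_typing_def extremal_adj_def doubleton_eq_iff split: if_splits)
  define \<phi> :: "nat \<Rightarrow> real" where "\<phi> i = (if i = 1 \<or> i = 3 then 1 else if i = 4 then 2 else 0)" for i
  define f where "f v = \<phi> (standard_typing n v)" for v
  have f: "f 0 = 0" "f 1 = 1" "f 2 = 0" "\<And>v. v \<in> {3..<k} \<Longrightarrow> f v = 1" "\<And>v. v \<in> {k..<n} \<Longrightarrow> f v = 2"
    using k by (auto simp: f_def \<phi>_def standard_typing_def)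
  have lip: "f v - f u \<le> 1" if "(u, v) \<in> parcs (extremal_graph n)" for u v
  \<comment> \<open>A jump above 1 can only lead from value 0 to value 2, that is from type 0 or 2
    to type 4, and those types are not adjacent.\<close>
  proof (rule ccontr)
    assume "\<not> f v - f u \<le> 1"
    hence "standard_typing n v = 4" "standard_typing n u \<notin> {1, 3, 4}"
      by (auto simp: f_def \<phi>_def split: if_splits)
    moreover have "standard_typing n u < 5" by (simp add: standard_typing_def)
    ultimately have "standard_typing n v = 4" "standard_typing n u \<in> {0, 2}" by auto
    thus False using that by (auto simp: extremal_graph_def extremal_adj_def insert_commute)
  qed
  have sY: "(\<Sum>z\<in>nbs (extremal_graph n) 1. f z) = 3 * real k - 3"
  proof -
    have "(\<Sum>z\<in>nbs (extremal_graph n) 1. f z) = (\<Sum>z\<in>{0}. f z) + (\<Sum>z\<in>{3..<k}. f z) + (\<Sum>z\<in>{k..<n}. f z)"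
    proof -
      have "{0} \<inter> {3..<k} = {}" "({0} \<union> {3..<k}) \<inter> {k..<n} = {}" using k by auto
      thus ?thesis unfolding Y by (simp only: sum.union_disjoint finite_Un finite_atLeastLessThan finite.intros simp_thms)
    qed
    also have "\<dots> = (\<Sum>z\<in>{3..<k}. 1) + (\<Sum>z\<in>{k..<n}. 2)" using f by simp
    finally show ?thesis using k by simp
  qed
  have cY: "card (nbs (extremal_graph n) 1) = 2 * k - 2"
  proof -
    have "{0} \<union> {3..<k} \<union> {k..<n} = insert 0 {3..<n}" using k by auto
    thus ?thesis unfolding Y using k by simp
  qed
  have "transport_dist (extremal_graph n) (lazy_walk_measure (extremal_graph n) p 0) (lazy_walk_measure (extremal_graph n) p 1) \<ge> 1"
    if p: "p \<in> {0<..<1}" for p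
  proof -
    have V: "0 \<in> pverts (extremal_graph n)" "1 \<in> pverts (extremal_graph n)" using n by (auto simp: extremal_graph_def)
    have "(3 * real k - 3) / real (2 * k - 2) = 3 / 2" using k by (simp add: of_nat_diff field_simps)
    hence s1: "(\<Sum>v\<in>pverts (extremal_graph n). f v * lazy_walk_measure (extremal_graph n) p 1 v) = p + (1 - p) * (3 / 2)"
      unfolding E.sum_lazy_walk[OF V(2)] sY cY f by (metis mult.right_neutral times_divide_eq_left times_divide_eq_right)
    have s0: "(\<Sum>v\<in>pverts (extremal_graph n). f v * lazy_walk_measure (extremal_graph n) p 0 v) = (1 - p) / 2"
      unfolding E.sum_lazy_walk[OF V(1)] X using f by simp
    have s: "p + (1 - p) * (3 / 2) - (1 - p) / 2 = 1" by (simp add: field_simps)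
    show ?thesis
      using E.transport_dist_ge[of f "lazy_walk_measure (extremal_graph n) p 1" "lazy_walk_measure (extremal_graph n) p 0", OF lip]
      unfolding s1 s0 s one_ereal_def .
  qed
  thus "kappa_LLY (extremal_graph n) 0 1 \<le> 0" using E.kappa_LLY_nonpos_iff[OF a] by simp
qed

text \<open>Listing the non-edges is needed only for an upper bound; the matching lower bound is the
  general one, applied to the edge of nonpositive curvature.\<close>

lemma extremal_graph_non_edges:
  assumes n: "12 \<le> n" "even n"
  shows "2 * card (non_edges (extremal_graph n)) + 4 = 3 * n"
proof -
  interpret E: pair_graph "extremal_graph n" by (rule pair_graph_extremal_graph)
  obtain k where k: "n = 2 * k" "6 \<le> k" using n by (auto elim!: evenE)
  let ?E = "insert {1, 2} ((\<lambda>v. {0, v}) ` {3..<n} \<union> (\<lambda>v. {2, v}) ` {k..<n})"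
  have "non_edges (extremal_graph n) \<subseteq> ?E"
  proof
    fix e assume "e \<in> non_edges (extremal_graph n)"
    then obtain u v where e: "e = {u, v}" "u < v" "v < n" "\<not> extremal_adj (standard_typing n u) (standard_typing n v)"
      unfolding non_edges_def using extremal_adj_sym
      by (auto simp: extremal_graph_def) (metis insert_commute linorder_neqE_nat)
    thus "e \<in> ?E" using k by (auto simp: extremal_adj_def doubleton_eq_iff standard_typing_def split: if_splits)
  qed
  hence "card (non_edges (extremal_graph n)) \<le> card ?E" by (rule card_mono[rotated]) simp
  also have "\<dots> \<le> Suc (card ((\<lambda>v. {0, v}) ` {3..<n} \<union> (\<lambda>v. {2, v}) ` {k..<n}))" by (rule card_insert_le_m1) auto
  also have "card ((\<lambda>v. {0, v}) ` {3..<n} \<union> (\<lambda>v. {2, v}) ` {k..<n}) \<le> card {3..<n} + card {k..<n}"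
    by (rule order_trans[OF card_Un_le add_mono[OF card_image_le card_image_le]]) auto
  finally have "card (non_edges (extremal_graph n)) \<le> 3 * k - 2" using k by simp
  moreover have "3 * card (pverts (extremal_graph n)) \<le> 2 * card (non_edges (extremal_graph n)) + 4"
    using E.non_edges_bound(1)[OF extremal_graph_kappa[OF n]] n by (simp add: extremal_graph_def)
  ultimately show ?thesis using k by (simp add: extremal_graph_def)
qed

section \<open>From non-edges back to the edge threshold\<close>

lemma real_num_edges:
  assumes "pair_graph G"
  shows "real (num_edges G) = real (card (pverts G)) * (real (card (pverts G)) - 1) / 2 - real (card (non_edges G))"
proof -
  have "real (num_edges G) + real (card (non_edges G)) = real (card (pverts G) choose 2)"
    using pair_graph.num_edges_non_edges[OF assms] by (metis of_nat_add)
  moreover have "real (m choose 2) = real m * (real m - 1) / 2" for m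
    by (cases m) (simp_all add: choose_two real_of_nat_div algebra_simps)
  ultimately show ?thesis by simp
qed

lemma edge_threshold_non_edges:
  assumes "pair_graph G"
  shows "edge_threshold (int (card (pverts G))) < real (num_edges G) \<Longrightarrow> 2 * card (non_edges G) + 4 < 3 * card (pverts G)"
    and "even (card (pverts G)) \<Longrightarrow>
      real (num_edges G) = edge_threshold (int (card (pverts G))) \<longleftrightarrow> 2 * card (non_edges G) + 4 = 3 * card (pverts G)"
proof -
  let ?n = "card (pverts G)" and ?m = "card (non_edges G)"
  let ?c = "\<lceil>of_int (int ?n) / 2 :: real\<rceil>"
  have diff: "real (num_edges G) - edge_threshold (int ?n) = real ?n + real_of_int ?c - 2 - real ?m"
    unfolding real_num_edges[OF assms] edge_threshold_def by (simp add: field_simps power2_eq_square)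
  show "2 * ?m + 4 < 3 * ?n" if "edge_threshold (int ?n) < real (num_edges G)"
  proof -
    \<comment> \<open>For odd n the ceiling gains 1/2, but on integers the strict inequalities gain
      enough to give 2 m + 4 < 3 n all the same, with m the number of non-edges.\<close>
    have "real_of_int ?c < real ?n / 2 + 1" by linarith
    hence "real_of_int (2 * ?c) < real_of_int (int ?n + 2)" by simp
    hence "2 * ?c < int ?n + 2" by linarith
    moreover have "real_of_int (int ?m) < real_of_int (int ?n + ?c - 2)" using diff that by simp
    hence "int ?m < int ?n + ?c - 2" by linarith
    ultimately show ?thesis by linarith
  qed
  assume "even ?n"
  then obtain k where k: "?n = 2 * k" by (auto elim: evenE)
  hence "?c = int k" by simp
  thus "real (num_edges G) = edge_threshold (int ?n) \<longleftrightarrow> 2 * ?m + 4 = 3 * ?n"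
    using diff k by auto
qed

theorem theorem1p1:
  shows "(\<forall>n::int. n \<ge> 8 \<longrightarrow>
            (\<forall>G::'a pair_pre_digraph.
               pair_graph G \<and> int (card (pverts G)) = n \<and> real (num_edges G) > edge_threshold n \<longrightarrow>
               (\<forall>(x, y)\<in>parcs G. kappa_LLY G x y > 0)))
       \<and> (\<forall>n::int. n \<ge> 12 \<and> even n \<longrightarrow>
            (\<exists>G::nat pair_pre_digraph.
               pair_graph G \<and> int (card (pverts G)) = n \<and> real (num_edges G) = edge_threshold n \<and>
               (\<exists>(x, y)\<in>parcs G. kappa_LLY G x y \<le> 0) \<and>
               (\<forall>H::'a pair_pre_digraph.
                  pair_graph H \<and> int (card (pverts H)) = n \<and> real (num_edges H) = edge_threshold n \<and>
                  (\<exists>(x, y)\<in>parcs H. kappa_LLY H x y \<le> 0) \<longrightarrow>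
                  digraph_iso (with_proj G) (with_proj H))))"
proof (intro conjI allI impI)
  fix n :: int and G :: "'a pair_pre_digraph"
  assume n: "n \<ge> 8" and G: "pair_graph G \<and> int (card (pverts G)) = n \<and> real (num_edges G) > edge_threshold n"
  interpret pair_graph G using G by blast
  have m: "2 * card (non_edges G) + 4 < 3 * card (pverts G)"
    using edge_threshold_non_edges(1) G by blast
  show "\<forall>(x, y)\<in>parcs G. kappa_LLY G x y > 0"
  proof (intro ballI, clarify, rule ccontr)
    fix x y assume "(x, y) \<in> parcs G" "\<not> kappa_LLY G x y > 0"
    hence "3 * card (pverts G) \<le> 2 * card (non_edges G) + 4"
      using G n by (intro non_edges_bound(1)) auto
    thus False using m by simp
  qed
next
  fix n :: int assume n: "n \<ge> 12 \<and> even n"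
  define m where "m = nat n"
  have m: "n = int m" "12 \<le> m" "even m" using n by (auto simp: m_def even_nat_iff)
  have E: "pair_graph (extremal_graph m)" "card (pverts (extremal_graph m)) = m"
    using pair_graph_extremal_graph by (auto simp: extremal_graph_def)
  show "\<exists>G::nat pair_pre_digraph.
               pair_graph G \<and> int (card (pverts G)) = n \<and> real (num_edges G) = edge_threshold n \<and>
               (\<exists>(x, y)\<in>parcs G. kappa_LLY G x y \<le> 0) \<and>
               (\<forall>H::'a pair_pre_digraph.
                  pair_graph H \<and> int (card (pverts H)) = n \<and> real (num_edges H) = edge_threshold n \<and>
                  (\<exists>(x, y)\<in>parcs H. kappa_LLY H x y \<le> 0) \<longrightarrow>
                  digraph_iso (with_proj G) (with_proj H))"
  proof (intro exI[of _ "extremal_graph m"] conjI allI impI)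
    show "pair_graph (extremal_graph m)" "int (card (pverts (extremal_graph m))) = n" using E m by auto
    show "real (num_edges (extremal_graph m)) = edge_threshold n"
      using edge_threshold_non_edges(2)[OF E(1)] extremal_graph_non_edges[OF m(2,3)] m E(2) by simp
    show "\<exists>(x, y)\<in>parcs (extremal_graph m). kappa_LLY (extremal_graph m) x y \<le> 0"
      using extremal_graph_kappa[OF m(2,3)] by blast
    fix H :: "'a pair_pre_digraph"
    assume H: "pair_graph H \<and> int (card (pverts H)) = n \<and> real (num_edges H) = edge_threshold n \<and>
                  (\<exists>(x, y)\<in>parcs H. kappa_LLY H x y \<le> 0)"
    interpret H: pair_graph H using H by blast
    have cH: "card (pverts H) = m" using H m by auto
    obtain x y where xy: "(x, y) \<in> parcs H" "kappa_LLY H x y \<le> 0" using H by blast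
    have "2 * card (non_edges H) + 4 = 3 * card (pverts H)"
      using edge_threshold_non_edges(2)[of H] H m cH by simp
    then obtain t where "extremal_typing H t" using H.non_edges_bound(2)[OF xy] cH m(2) by auto
    thus "digraph_iso (with_proj (extremal_graph m)) (with_proj H)"
      using extremal_typing_iso[of "extremal_graph m" H] extremal_typing_extremal_graph[OF m(2,3)] E cH H by simp
  qed
qed

end
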